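(* Let $A\in\mathbb{R}^{n\times n}$ be symmetric with spectral decomposition $A=V\Lambda V^T$, where $V=(v_1,\ldots,v_n)$ is orthogonal and $\Lambda=\mathrm{diag}(\lambda_1,\ldots,\lambda_n)$, and let $\sigma_j=|\lambda_j|$ be the singular values of $A$, with $\sigma_1>\sigma_2>\cdots>\sigma_n>0$. Let $b\in\mathbb{R}^n$ satisfy $v_j^Tb\ne0$ for $j=1,\ldots,n$. Assume that the problem $Ax=b$ is severely ill-posed ($\sigma_j=\mathcal{O}(e^{-\alpha j})$ with $\alpha>0$) or moderately ill-posed ($\sigma_j=\mathcal{O}(j^{-\alpha})$ with $\alpha>1$). For $k=1,\ldots,n-1$, let $Q_k$, $Q_{k+1}$, $T_k$ be the matrices generated by the $k$-step symmetric Lanczos process for $A$ with starting vector $q_1=Ab/\|Ab\|$, and let $\gamma_k=\|A-Q_{k+1}T_kQ_k^T\|$. Let $\mathcal{V}_k=\mathrm{span}\{v_1,\ldots,v_k\}$ and $\mathcal{V}_k^s=\mathcal{K}_k(A,Ab)$. Then $$|\lambda_{k+1}|\le\gamma_k\le|\lambda_{k+1}|+|\lambda_1|\,\|\sin\Theta(\mathcal{V}_k,\mathcal{V}_k^s)\|.$$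
   Context: $\|\cdot\|$ is the 2-norm of a vector or matrix. $\mathcal{K}_k(A,w)=\mathrm{span}\{w,Aw,\ldots,A^{k-1}w\}$. Symmetric Lanczos process: with $q_1=Ab/\|Ab\|$, the $k$-step process produces $Q_{k+1}=(q_1,\ldots,q_{k+1})$ with orthonormal columns, $Q_k=(q_1,\ldots,q_k)$, and $T_k\in\mathbb{R}^{(k+1)\times k}$ such that $AQ_k=Q_{k+1}T_k$. Here $T_k$ is tridiagonal with diagonal entries $\alpha_1,\ldots,\alpha_k$, subdiagonal entries $\beta_1,\ldots,\beta_k>0$ and superdiagonal entries $\beta_1,\ldots,\beta_{k-1}$; its first $k$ rows form a symmetric matrix. The columns of $Q_k$ form an orthonormal basis of $\mathcal{K}_k(A,Ab)$. Under the assumptions on $A$ and $b$ the process does not break down for $k\le n-1$. For two $k$-dimensional subspaces $\mathcal{X},\mathcal{Y}$ of $\mathbb{R}^n$, $\Theta(\mathcal{X},\mathcal{Y})$ denotes their canonical angles, and $\|\sin\Theta(\mathcal{X},\mathcal{Y})\|=\|X_\perp^TY\|$, where the columns of $X_\perp$ and $Y$ form orthonormal bases of the orthogonal complement of $\mathcal{X}$ and of $\mathcal{Y}$, respectively. *)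

theory Defs
  imports Complex_Main "Jordan_Normal_Form.VS_Connect"
begin

definition norm2_vec :: "real vec \<Rightarrow> real" where
  "norm2_vec x = sqrt (scalar_prod x x)"

definition norm2_mat :: "real mat \<Rightarrow> real" where
  "norm2_mat M = Sup {norm2_vec (M *\<^sub>v x) | x. x \<in> carrier_vec (dim_col M) \<and> norm2_vec x \<le> 1}"

(* In both definitions sigma is indexed from 1.  As n is fixed, the O-bound is a bound with
   an unspecified constant C over the n available indices. *)
definition severely_ill_posed :: "nat \<Rightarrow> (nat \<Rightarrow> real) \<Rightarrow> bool" where
  "severely_ill_posed n \<sigma> \<longleftrightarrow>
     (\<exists>\<alpha> > 0. \<exists>C > 0. \<forall>j\<in>{1..n}. \<sigma> j \<le> C * exp (- \<alpha> * real j))"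

definition moderately_ill_posed :: "nat \<Rightarrow> (nat \<Rightarrow> real) \<Rightarrow> bool" where
  "moderately_ill_posed n \<sigma> \<longleftrightarrow>
     (\<exists>\<alpha> > 1. \<exists>C > 0. \<forall>j\<in>{1..n}. \<sigma> j \<le> C * real j powr (- \<alpha>))"

abbreviation span_vec :: "nat \<Rightarrow> real vec set \<Rightarrow> real vec set" where
  "span_vec n S \<equiv> LinearCombinations.module.span class_ring (module_vec TYPE(real) n) S"

definition krylov :: "nat \<Rightarrow> real mat \<Rightarrow> real vec \<Rightarrow> nat \<Rightarrow> real vec set" where
  "krylov n A w k = span_vec n ((\<lambda>i. (A ^\<^sub>m i) *\<^sub>v w) ` {..<k})"

definition orthonormal_basis_mat :: "nat \<Rightarrow> real mat \<Rightarrow> real vec set \<Rightarrow> bool" where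
  "orthonormal_basis_mat n B S \<longleftrightarrow>
     dim_row B = n \<and> transpose_mat B * B = 1\<^sub>m (dim_col B) \<and> span_vec n (set (cols B)) = S"

(* The norm of sin Theta(X, Y), for subspaces X and Y of R^n of equal dimension; the value
   does not depend on the choice of the two orthonormal bases. *)
definition norm_sin_Theta :: "nat \<Rightarrow> real vec set \<Rightarrow> real vec set \<Rightarrow> real" where
  "norm_sin_Theta n X Y = (SOME s. \<exists>Xp Y'.
     orthonormal_basis_mat n Xp (vec_module.orthogonal_complement n X) \<and>
     orthonormal_basis_mat n Y' Y \<and>
     s = norm2_mat (transpose_mat Xp * Y'))"

(* Symmetric Lanczos process for A with starting vector w / ||w||.  The state after j steps is
   (q_j, beta_j, q_{j+1}), with q_0 = 0 and beta_0 = 0; step j+1 is the three-term recurrence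
     beta_{j+1} q_{j+2} = A q_{j+1} - alpha_{j+1} q_{j+1} - beta_j q_j,
     alpha_{j+1} = q_{j+1}^T A q_{j+1}.
   In case of breakdown (beta_{j+1} = 0) it returns q_{j+2} = 0, because 1 / 0 = 0. *)
primrec lanczos_state ::
  "nat \<Rightarrow> real mat \<Rightarrow> real vec \<Rightarrow> nat \<Rightarrow> real vec \<times> real \<times> real vec" where
  "lanczos_state n A w 0 = (0\<^sub>v n, 0, (1 / norm2_vec w) \<cdot>\<^sub>v w)"
| "lanczos_state n A w (Suc j) =
     (case lanczos_state n A w j of (p, \<beta>, q) \<Rightarrow>
        let \<alpha> = scalar_prod q (A *\<^sub>v q);
            r = A *\<^sub>v q - \<alpha> \<cdot>\<^sub>v q - \<beta> \<cdot>\<^sub>v p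
        in (q, norm2_vec r, (1 / norm2_vec r) \<cdot>\<^sub>v r))"

definition lanczos_q :: "nat \<Rightarrow> real mat \<Rightarrow> real vec \<Rightarrow> nat \<Rightarrow> real vec" where
  "lanczos_q n A w j = fst (lanczos_state n A w j)"

definition lanczos_\<alpha> :: "nat \<Rightarrow> real mat \<Rightarrow> real vec \<Rightarrow> nat \<Rightarrow> real" where
  "lanczos_\<alpha> n A w j = scalar_prod (lanczos_q n A w j) (A *\<^sub>v lanczos_q n A w j)"

definition lanczos_\<beta> :: "nat \<Rightarrow> real mat \<Rightarrow> real vec \<Rightarrow> nat \<Rightarrow> real" where
  "lanczos_\<beta> n A w j = fst (snd (lanczos_state n A w j))"

definition lanczos_Q :: "nat \<Rightarrow> real mat \<Rightarrow> real vec \<Rightarrow> nat \<Rightarrow> real mat" where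
  "lanczos_Q n A w k = mat_of_cols n (map (lanczos_q n A w) [1..<k + 1])"

(* Matrix indices (i, j) start at 0, those of alpha and beta at 1. *)
definition lanczos_T :: "nat \<Rightarrow> real mat \<Rightarrow> real vec \<Rightarrow> nat \<Rightarrow> real mat" where
  "lanczos_T n A w k = mat (k + 1) k (\<lambda>(i, j).
     if i = j then lanczos_\<alpha> n A w (j + 1)
     else if i = j + 1 then lanczos_\<beta> n A w (j + 1)
     else if j = i + 1 then lanczos_\<beta> n A w (i + 1)
     else 0)"

end

theory Submission
  imports Defs
begin

text \<open>
The Lanczos relation \<open>A Q\<^sub>k = Q\<^sub>k\<^sub>+\<^sub>1 T\<^sub>k\<close> shows that \<open>\<gamma>\<^sub>k\<close> is the norm of \<open>A (1 - P)\<close>, where \<open>P = Q\<^sub>k Q\<^sub>k\<^sup>T\<close>. The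
Lanczos vectors are orthonormal and span the Krylov space, so \<open>P\<close> is the orthogonal projection onto it.

For the lower bound, count dimensions: the kernel of \<open>Q\<^sub>k\<^sup>T\<close> meets the span of \<open>v\<^sub>1, ..., v\<^sub>k\<^sub>+\<^sub>1\<close> in a nonzero
vector \<open>x\<close>, and there \<open>|A (1 - P) x| = |A x| \<ge> |\<lambda>\<^sub>k\<^sub>+\<^sub>1| |x|\<close>
(\<open>norm2_mat_ge_of_agree_on_kernel\<close>).

For the upper bound, split \<open>A\<close> into its leading part, of norm \<open>|\<lambda>\<^sub>1|\<close> and acting on the span of
\<open>v\<^sub>1, ..., v\<^sub>k\<close>, and the rest, of norm \<open>|\<lambda>\<^sub>k\<^sub>+\<^sub>1|\<close>. With \<open>V\<^sub>k = (v\<^sub>1, ..., v\<^sub>k)\<close> this gives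
\<open>|A (1 - P) x| \<le> |\<lambda>\<^sub>k\<^sub>+\<^sub>1| |x| + |\<lambda>\<^sub>1| |V\<^sub>k\<^sup>T (1 - P) x|\<close> (\<open>norm2_spectral_le\<close>). The norm of
\<open>V\<^sub>k\<^sup>T (1 - P)\<close> equals that of its transpose \<open>(1 - P) V\<^sub>k\<close>, whereas the sine of the largest canonical
angle is the norm of \<open>(1 - V\<^sub>k V\<^sub>k\<^sup>T) Q\<^sub>k\<close>. These agree because both subspaces have dimension \<open>k\<close>: by
Pythagoras each is determined by the smallest singular value of the square matrix \<open>V\<^sub>k\<^sup>T Q\<^sub>k\<close>, respectively
of its transpose (\<open>frame_gap_symmetric\<close>).

Orthonormality of the Lanczos vectors requires that the process does not break down. In spectral
coordinates \<open>q\<^sub>j\<^sub>+\<^sub>1\<close> is a polynomial of degree exactly \<open>j\<close> evaluated at the eigenvalues, multiplied by the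
coordinates of \<open>A b\<close>. A breakdown before step \<open>n\<close> would be a nonzero polynomial of degree below \<open>n\<close> with the
\<open>n\<close> distinct eigenvalues as roots (\<open>lanczos_no_breakdown\<close>).
\<close>

section \<open>The Euclidean norm and the induced matrix norm\<close>

lemma norm2_vec_nonneg: "0 \<le> norm2_vec x"
  by (simp add: norm2_vec_def scalar_prod_def sum_nonneg)

lemma norm2_vec_sq: "(norm2_vec x)\<^sup>2 = x \<bullet> x"
  by (simp add: norm2_vec_def scalar_prod_def sum_nonneg)

lemma norm2_vec_eq_0_iff:
  assumes "x \<in> carrier_vec n"
  shows "norm2_vec x = 0 \<longleftrightarrow> x = 0\<^sub>v n"
proof -
  have "norm2_vec x = 0 \<longleftrightarrow> (\<Sum>i = 0..<n. x $ i * x $ i) = 0"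
    using assms by (simp add: norm2_vec_def scalar_prod_def)
  also have "\<dots> \<longleftrightarrow> (\<forall>i\<in>{0..<n}. x $ i * x $ i = 0)"
    by (rule sum_nonneg_eq_0_iff) auto
  also have "\<dots> \<longleftrightarrow> x = 0\<^sub>v n"
    using assms by (auto simp: vec_eq_iff)
  finally show ?thesis .
qed

lemma norm2_vec_smult: "norm2_vec (c \<cdot>\<^sub>v x) = \<bar>c\<bar> * norm2_vec x"
proof (rule power2_eq_imp_eq)
  show "(norm2_vec (c \<cdot>\<^sub>v x))\<^sup>2 = (\<bar>c\<bar> * norm2_vec x)\<^sup>2"
    by (simp add: norm2_vec_sq power_mult_distrib power2_eq_square[of c])
qed (simp_all add: norm2_vec_nonneg)

lemma norm2_vec_leI:
  assumes "x \<bullet> x \<le> c\<^sup>2" and "0 \<le> c"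
  shows "norm2_vec x \<le> c"
  using assms by (simp add: norm2_vec_sq[symmetric] power2_le_iff_abs_le norm2_vec_nonneg)

lemma Cauchy_Schwarz_vec:
  fixes x y :: "real vec"
  assumes "x \<in> carrier_vec n" and "y \<in> carrier_vec n"
  shows "(x \<bullet> y)\<^sup>2 \<le> (x \<bullet> x) * (y \<bullet> y)"
proof (cases "y \<bullet> y = 0")
  case True
  then have "y = 0\<^sub>v n"
    using norm2_vec_eq_0_iff[OF assms(2)] norm2_vec_sq[of y] by simp
  then show ?thesis using assms by simp
next
  case False
  then have pos: "0 < y \<bullet> y"
    using norm2_vec_sq[of y] zero_le_power2[of "norm2_vec y"] by linarith
  \<comment> \<open>The component of \<open>x\<close> orthogonal to \<open>y\<close>, scaled by \<open>y \<bullet> y\<close> to avoid a division.\<close>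
  let ?r = "(y \<bullet> y) \<cdot>\<^sub>v x - (x \<bullet> y) \<cdot>\<^sub>v y"
  have "0 \<le> ?r \<bullet> ?r"
    by (metis norm2_vec_sq zero_le_power2)
  also have "?r \<bullet> ?r = (y \<bullet> y) * ((x \<bullet> x) * (y \<bullet> y) - (x \<bullet> y)\<^sup>2)"
    using assms comm_scalar_prod[OF assms]
    by (simp add: minus_scalar_prod_distrib[of _ n] scalar_prod_minus_distrib[of _ n]
        power2_eq_square algebra_simps)
  finally show ?thesis
    using pos by (simp add: zero_le_mult_iff)
qed

lemma scalar_prod_le_norm2:
  assumes "x \<in> carrier_vec n" and "y \<in> carrier_vec n"
  shows "x \<bullet> y \<le> norm2_vec x * norm2_vec y"
proof -
  have "(x \<bullet> y)\<^sup>2 \<le> (norm2_vec x * norm2_vec y)\<^sup>2"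
    using Cauchy_Schwarz_vec[OF assms] by (simp add: power_mult_distrib norm2_vec_sq)
  then show ?thesis
    by (rule power2_le_imp_le) (simp add: norm2_vec_nonneg)
qed

text \<open>The supremum in the matrix norm is over a set of reals, so it carries information only once this set
is known to be bounded. The Frobenius norm serves as the bound.\<close>

lemma norm2_mult_mat_vec_bounded:
  assumes "M \<in> carrier_mat m n"
  obtains C where "0 \<le> C" and "\<And>x. x \<in> carrier_vec n \<Longrightarrow> norm2_vec (M *\<^sub>v x) \<le> C * norm2_vec x"
proof
  let ?S = "\<Sum>i<m. row M i \<bullet> row M i"
  have S: "0 \<le> ?S"
    by (rule sum_nonneg) (metis norm2_vec_sq zero_le_power2)
  then show "0 \<le> sqrt ?S" by simp
  fix x :: "real vec" assume x: "x \<in> carrier_vec n"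
  have "(M *\<^sub>v x) \<bullet> (M *\<^sub>v x) = (\<Sum>i<m. (row M i \<bullet> x)\<^sup>2)"
    using assms by (simp add: scalar_prod_def[of "M *\<^sub>v x" "M *\<^sub>v x"] power2_eq_square lessThan_atLeast0)
  also have "\<dots> \<le> (\<Sum>i<m. (row M i \<bullet> row M i) * (x \<bullet> x))"
    by (rule sum_mono) (use assms x in \<open>auto intro!: Cauchy_Schwarz_vec[of _ n]\<close>)
  also have "\<dots> = (sqrt ?S * norm2_vec x)\<^sup>2"
    using S by (simp add: power_mult_distrib norm2_vec_sq sum_distrib_right)
  finally show "norm2_vec (M *\<^sub>v x) \<le> sqrt ?S * norm2_vec x"
    by (rule norm2_vec_leI) (use S norm2_vec_nonneg[of x] in simp)
qed

lemma norm2_mult_unit_ball_le: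
  assumes M: "M \<in> carrier_mat m n" and x: "x \<in> carrier_vec n" and unit: "norm2_vec x \<le> 1"
  shows "norm2_vec (M *\<^sub>v x) \<le> norm2_mat M"
proof -
  obtain C where C: "0 \<le> C" "\<And>x. x \<in> carrier_vec n \<Longrightarrow> norm2_vec (M *\<^sub>v x) \<le> C * norm2_vec x"
    using norm2_mult_mat_vec_bounded[OF M] by blast
  have "norm2_vec (M *\<^sub>v y) \<le> C" if "y \<in> carrier_vec n" "norm2_vec y \<le> 1" for y
    using C(2)[OF that(1)] mult_left_mono[OF that(2) C(1)] by linarith
  then have "bdd_above {norm2_vec (M *\<^sub>v x) | x. x \<in> carrier_vec (dim_col M) \<and> norm2_vec x \<le> 1}"
    using M by (auto intro!: bdd_aboveI[of _ C])
  moreover have "norm2_vec (M *\<^sub>v x) \<in> {norm2_vec (M *\<^sub>v x) | x. x \<in> carrier_vec (dim_col M) \<and> norm2_vec x \<le> 1}"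
    using x unit M by auto
  ultimately show ?thesis
    unfolding norm2_mat_def by (rule cSup_upper[rotated])
qed

lemma norm2_mult_mat_vec_le:
  assumes M: "M \<in> carrier_mat m n" and x: "x \<in> carrier_vec n"
  shows "norm2_vec (M *\<^sub>v x) \<le> norm2_mat M * norm2_vec x"
proof (cases "norm2_vec x = 0")
  case True
  have "M *\<^sub>v 0\<^sub>v n = 0\<^sub>v m"
    using M by (intro eq_vecI) auto
  with True show ?thesis
    using norm2_vec_eq_0_iff[OF x] norm2_vec_eq_0_iff[of "0\<^sub>v m" m] by simp
next
  case False
  then have pos: "0 < norm2_vec x" using norm2_vec_nonneg[of x] by linarith
  let ?u = "(1 / norm2_vec x) \<cdot>\<^sub>v x"
  have "norm2_vec (M *\<^sub>v ?u) \<le> norm2_mat M"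
    by (rule norm2_mult_unit_ball_le[OF M]) (use x pos in \<open>auto simp: norm2_vec_smult\<close>)
  moreover have "M *\<^sub>v ?u = (1 / norm2_vec x) \<cdot>\<^sub>v (M *\<^sub>v x)"
    using M x by (simp add: mult_mat_vec)
  ultimately show ?thesis
    using pos by (simp add: norm2_vec_smult divide_le_eq)
qed

lemma norm2_mat_nonneg: "0 \<le> norm2_mat M"
proof -
  have "norm2_vec (0\<^sub>v (dim_col M)) \<le> 1"
    using norm2_vec_eq_0_iff[of "0\<^sub>v (dim_col M)" "dim_col M"] by simp
  then have "norm2_vec (M *\<^sub>v 0\<^sub>v (dim_col M)) \<le> norm2_mat M"
    by (intro norm2_mult_unit_ball_le[of M "dim_row M" "dim_col M"]) auto
  then show ?thesis using norm2_vec_nonneg order.trans by blast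
qed

lemma norm2_mat_leI:
  assumes M: "M \<in> carrier_mat m n"
    and "\<And>x. x \<in> carrier_vec n \<Longrightarrow> norm2_vec (M *\<^sub>v x) \<le> c * norm2_vec x" and "0 \<le> c"
  shows "norm2_mat M \<le> c"
  unfolding norm2_mat_def
proof (rule cSup_least)
  show "{norm2_vec (M *\<^sub>v x) | x. x \<in> carrier_vec (dim_col M) \<and> norm2_vec x \<le> 1} \<noteq> {}"
    using norm2_vec_eq_0_iff[of "0\<^sub>v (dim_col M)" "dim_col M"]
    by (auto intro!: exI[of _ "0\<^sub>v (dim_col M)"])
next
  fix r assume "r \<in> {norm2_vec (M *\<^sub>v x) | x. x \<in> carrier_vec (dim_col M) \<and> norm2_vec x \<le> 1}"
  then obtain x where "r = norm2_vec (M *\<^sub>v x)" "x \<in> carrier_vec n" "norm2_vec x \<le> 1"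
    using M by auto
  moreover have "c * norm2_vec x \<le> c" if "norm2_vec x \<le> 1" for x
    using mult_left_mono[OF that assms(3)] by simp
  ultimately show "r \<le> c" using assms(2) order.trans by blast
qed

section \<open>Orthonormal frames and the gap between their ranges\<close>

lemma mult_mat_vec_carrier_row [simp]:
  "Q \<in> carrier_mat n k \<Longrightarrow> Q *\<^sub>v y \<in> carrier_vec n"
  by (rule carrier_vecI) simp

lemma transpose_mult_mat_vec_carrier [simp]:
  "Q \<in> carrier_mat n k \<Longrightarrow> transpose_mat Q *\<^sub>v y \<in> carrier_vec k"
  by (rule carrier_vecI) simp

text \<open>A matrix \<open>Q\<close> with \<open>Q\<^sup>T Q = 1\<close> is called an orthonormal frame below. Its columns form an
orthonormal basis of a subspace, and \<open>x - Q Q\<^sup>T x\<close> is the residual of the orthogonal projection of \<open>x\<close>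
onto that subspace.\<close>

lemma transpose_frame_mult:
  fixes Q :: "real mat"
  assumes Q: "Q \<in> carrier_mat n k" and orth: "transpose_mat Q * Q = 1\<^sub>m k" and u: "u \<in> carrier_vec k"
  shows "transpose_mat Q *\<^sub>v (Q *\<^sub>v u) = u"
proof -
  have "transpose_mat Q *\<^sub>v (Q *\<^sub>v u) = (transpose_mat Q * Q) *\<^sub>v u"
    by (rule assoc_mult_mat_vec[symmetric]) (use Q u in auto)
  also have "\<dots> = u" unfolding orth by (rule one_mult_mat_vec[OF u])
  finally show ?thesis .
qed

lemma norm2_frame_mult:
  assumes Q: "Q \<in> carrier_mat n k" and orth: "transpose_mat Q * Q = 1\<^sub>m k" and u: "u \<in> carrier_vec k"
  shows "norm2_vec (Q *\<^sub>v u) = norm2_vec u"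
proof -
  have "(Q *\<^sub>v u) \<bullet> (Q *\<^sub>v u) = (transpose_mat Q *\<^sub>v (Q *\<^sub>v u)) \<bullet> u"
    using transpose_vec_mult_scalar[OF Q u, of "Q *\<^sub>v u"] Q u by simp
  also have "transpose_mat Q *\<^sub>v (Q *\<^sub>v u) = u"
    by (rule transpose_frame_mult[OF assms])
  finally show ?thesis by (simp add: norm2_vec_def)
qed

lemma frame_residual_sq:
  assumes Q: "Q \<in> carrier_mat n k" and orth: "transpose_mat Q * Q = 1\<^sub>m k" and x: "x \<in> carrier_vec n"
  shows "(norm2_vec (x - Q *\<^sub>v (transpose_mat Q *\<^sub>v x)))\<^sup>2 = (norm2_vec x)\<^sup>2 - (norm2_vec (transpose_mat Q *\<^sub>v x))\<^sup>2"
proof -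
  let ?c = "transpose_mat Q *\<^sub>v x"
  have c: "?c \<in> carrier_vec k" and Qc: "Q *\<^sub>v ?c \<in> carrier_vec n" using Q x by auto
  have 1: "x \<bullet> (Q *\<^sub>v ?c) = ?c \<bullet> ?c"
    using transpose_vec_mult_scalar[OF Q c x] by simp
  have 2: "(Q *\<^sub>v ?c) \<bullet> (Q *\<^sub>v ?c) = ?c \<bullet> ?c"
    using norm2_frame_mult[OF Q orth c] by (metis norm2_vec_sq)
  show ?thesis
    using x Qc 1 2 comm_scalar_prod[OF x Qc]
    by (simp add: norm2_vec_sq minus_scalar_prod_distrib[of _ n] scalar_prod_minus_distrib[of _ n])
qed

lemma norm2_frame_residual_le:
  assumes Q: "Q \<in> carrier_mat n k" and orth: "transpose_mat Q * Q = 1\<^sub>m k" and x: "x \<in> carrier_vec n"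
  shows "norm2_vec (x - Q *\<^sub>v (transpose_mat Q *\<^sub>v x)) \<le> norm2_vec x"
  by (rule power2_le_imp_le) (simp_all add: frame_residual_sq[OF assms] norm2_vec_nonneg)

text \<open>A positive lower bound makes \<open>M\<close> injective, hence invertible because it is square. With \<open>M w = z\<close> one has
\<open>|z|\<^sup>2 = M\<^sup>T z \<bullet> w \<le> |M\<^sup>T z| |w|\<close>, and the lower bound at \<open>w\<close> controls \<open>|w|\<close> by \<open>|z|\<close>.
In other words, \<open>M\<close> and \<open>M\<^sup>T\<close> have the same smallest singular value.\<close>

lemma transpose_bounded_below:
  fixes M :: "real mat"
  assumes M: "M \<in> carrier_mat k k" and c: "0 < c"
    and below: "\<And>u. u \<in> carrier_vec k \<Longrightarrow> c * (norm2_vec u)\<^sup>2 \<le> (norm2_vec (M *\<^sub>v u))\<^sup>2"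
    and z: "z \<in> carrier_vec k"
  shows "c * (norm2_vec z)\<^sup>2 \<le> (norm2_vec (transpose_mat M *\<^sub>v z))\<^sup>2"
proof -
  have "det M \<noteq> 0"
  proof
    assume "det M = 0"
    then obtain v where v: "v \<in> carrier_vec k" "v \<noteq> 0\<^sub>v k" "M *\<^sub>v v = 0\<^sub>v k"
      using det_0_iff_vec_prod_zero_field[OF M] by blast
    then have "c * (norm2_vec v)\<^sup>2 \<le> 0"
      using below[OF v(1)] norm2_vec_eq_0_iff[of "0\<^sub>v k" k] by simp
    then have "norm2_vec v = 0"
      using c by (simp add: mult_le_0_iff)
    then show False
      using norm2_vec_eq_0_iff[OF v(1)] v(2) by simp
  qed
  then have "M \<in> Units (ring_mat TYPE(real) k ())"
    by (rule det_non_zero_imp_unit[OF M])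
  then obtain N where N: "N \<in> carrier_mat k k" and MN: "M * N = 1\<^sub>m k"
    unfolding Units_def ring_mat_def by auto
  let ?w = "N *\<^sub>v z" and ?a = "norm2_vec (transpose_mat M *\<^sub>v z)"
  have w: "?w \<in> carrier_vec k" using N z by auto
  have Mw: "M *\<^sub>v ?w = z"
    using assoc_mult_mat_vec[OF M N z] MN z by simp
  have "(norm2_vec z)\<^sup>2 = (transpose_mat M *\<^sub>v z) \<bullet> ?w"
    using transpose_vec_mult_scalar[OF M w z] Mw by (simp add: norm2_vec_sq)
  also have "\<dots> \<le> ?a * norm2_vec ?w"
    by (rule scalar_prod_le_norm2) (use M w z in auto)
  finally have "((norm2_vec z)\<^sup>2)\<^sup>2 \<le> (?a * norm2_vec ?w)\<^sup>2"
    by (rule power_mono) simp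
  then have "c * ((norm2_vec z)\<^sup>2)\<^sup>2 \<le> ?a\<^sup>2 * (c * (norm2_vec ?w)\<^sup>2)"
    using c by (simp add: power_mult_distrib left_diff_distrib)
  also have "\<dots> \<le> ?a\<^sup>2 * (norm2_vec z)\<^sup>2"
    using below[OF w] Mw by (intro mult_left_mono) auto
  finally have *: "(c * (norm2_vec z)\<^sup>2) * (norm2_vec z)\<^sup>2 \<le> ?a\<^sup>2 * (norm2_vec z)\<^sup>2"
    by (simp add: power2_eq_square algebra_simps)
  show ?thesis
  proof (cases "norm2_vec z = 0")
    case False
    then show ?thesis using * by (auto dest!: mult_right_le_imp_le)
  qed simp
qed

text \<open>By Pythagoras, the residuals of unit vectors of \<open>range Q\<close> against \<open>X\<close> are at most \<open>s < 1\<close> exactly if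
\<open>X\<^sup>T Q\<close> is bounded below by \<open>sqrt (1 - s\<^sup>2)\<close>; with the roles exchanged, the same holds for its
transpose. Equal dimensions make \<open>X\<^sup>T Q\<close> square, so the two lower bounds are equivalent and the gap
between the subspaces is symmetric. If \<open>1 \<le> s\<close>, the claim is that residuals do not exceed the vector.\<close>

lemma frame_gap_symmetric:
  assumes X: "X \<in> carrier_mat n k" "transpose_mat X * X = 1\<^sub>m k"
    and Q: "Q \<in> carrier_mat n k" "transpose_mat Q * Q = 1\<^sub>m k"
    and s: "0 \<le> s"
    and gap: "\<And>u. u \<in> carrier_vec k \<Longrightarrow>
      norm2_vec (Q *\<^sub>v u - X *\<^sub>v (transpose_mat X *\<^sub>v (Q *\<^sub>v u))) \<le> s * norm2_vec u"
    and z: "z \<in> carrier_vec k"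
  shows "norm2_vec (X *\<^sub>v z - Q *\<^sub>v (transpose_mat Q *\<^sub>v (X *\<^sub>v z))) \<le> s * norm2_vec z"
proof (cases "1 \<le> s")
  case True
  have "norm2_vec (X *\<^sub>v z - Q *\<^sub>v (transpose_mat Q *\<^sub>v (X *\<^sub>v z))) \<le> 1 * norm2_vec z"
    using norm2_frame_residual_le[OF Q, of "X *\<^sub>v z"] norm2_frame_mult[OF X z] X z by simp
  also have "\<dots> \<le> s * norm2_vec z"
    using True norm2_vec_nonneg by (intro mult_right_mono)
  finally show ?thesis .
next
  case False
  then have c: "0 < 1 - s\<^sup>2"
    using s by (simp add: power_less_one_iff abs_square_less_1)
  let ?M = "transpose_mat X * Q"
  have M: "?M \<in> carrier_mat k k" using X Q by auto
  have Mu: "?M *\<^sub>v u = transpose_mat X *\<^sub>v (Q *\<^sub>v u)" if "u \<in> carrier_vec k" for u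
    using that X(1) Q(1) by simp
  have Mt: "transpose_mat ?M *\<^sub>v z = transpose_mat Q *\<^sub>v (X *\<^sub>v z)"
    using z X(1) Q(1) transpose_mult[of "transpose_mat X" k n Q k]
    by simp
  have "(1 - s\<^sup>2) * (norm2_vec u)\<^sup>2 \<le> (norm2_vec (?M *\<^sub>v u))\<^sup>2" if u: "u \<in> carrier_vec k" for u
  proof -
    have "(norm2_vec (Q *\<^sub>v u - X *\<^sub>v (transpose_mat X *\<^sub>v (Q *\<^sub>v u))))\<^sup>2 \<le> (s * norm2_vec u)\<^sup>2"
      using gap[OF u] norm2_vec_nonneg by (intro power_mono)
    moreover have "Q *\<^sub>v u \<in> carrier_vec n" using Q(1) u by simp
    ultimately show ?thesis
      using frame_residual_sq[OF X, of "Q *\<^sub>v u"]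
      unfolding Mu[OF u] norm2_frame_mult[OF Q u] power_mult_distrib left_diff_distrib by linarith
  qed
  then have "(1 - s\<^sup>2) * (norm2_vec z)\<^sup>2 \<le> (norm2_vec (transpose_mat ?M *\<^sub>v z))\<^sup>2"
    by (rule transpose_bounded_below[OF M c _ z])
  moreover have "X *\<^sub>v z \<in> carrier_vec n" using X(1) z by simp
  ultimately have "(norm2_vec (X *\<^sub>v z - Q *\<^sub>v (transpose_mat Q *\<^sub>v (X *\<^sub>v z))))\<^sup>2 \<le> (s * norm2_vec z)\<^sup>2"
    using frame_residual_sq[OF Q, of "X *\<^sub>v z"]
    unfolding Mt norm2_frame_mult[OF X z] power_mult_distrib left_diff_distrib by linarith
  then show ?thesis
    by (rule power2_le_imp_le) (use s norm2_vec_nonneg[of z] in simp)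
qed

lemma frame_projection_self_adjoint:
  fixes Q :: "real mat"
  assumes Q: "Q \<in> carrier_mat n k" and x: "x \<in> carrier_vec n" and y: "y \<in> carrier_vec n"
  shows "(x - Q *\<^sub>v (transpose_mat Q *\<^sub>v x)) \<bullet> y = x \<bullet> (y - Q *\<^sub>v (transpose_mat Q *\<^sub>v y))"
proof -
  have c: "transpose_mat Q *\<^sub>v x \<in> carrier_vec k" "transpose_mat Q *\<^sub>v y \<in> carrier_vec k"
    using Q x y by auto
  have Qc: "Q *\<^sub>v (transpose_mat Q *\<^sub>v x) \<in> carrier_vec n" "Q *\<^sub>v (transpose_mat Q *\<^sub>v y) \<in> carrier_vec n"
    using Q by auto
  have "(Q *\<^sub>v (transpose_mat Q *\<^sub>v x)) \<bullet> y = y \<bullet> (Q *\<^sub>v (transpose_mat Q *\<^sub>v x))"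
    by (rule comm_scalar_prod[OF Qc(1) y])
  also have "\<dots> = (transpose_mat Q *\<^sub>v y) \<bullet> (transpose_mat Q *\<^sub>v x)"
    by (rule transpose_vec_mult_scalar[OF Q c(1) y, symmetric])
  also have "\<dots> = (transpose_mat Q *\<^sub>v x) \<bullet> (transpose_mat Q *\<^sub>v y)"
    by (rule comm_scalar_prod[OF c(2) c(1)])
  also have "\<dots> = x \<bullet> (Q *\<^sub>v (transpose_mat Q *\<^sub>v y))"
    by (rule transpose_vec_mult_scalar[OF Q c(2) x])
  finally show ?thesis
    using x y Qc by (simp add: minus_scalar_prod_distrib[of _ n] scalar_prod_minus_distrib[of _ n])
qed

text \<open>The bound for \<open>(1 - Q Q\<^sup>T) X\<close> passes to its transpose \<open>X\<^sup>T (1 - Q Q\<^sup>T)\<close>: test the vector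
\<open>u = X\<^sup>T (x - Q Q\<^sup>T x)\<close> against itself and move the self-adjoint projection onto \<open>X u\<close>.\<close>

lemma norm2_transpose_residual_le:
  assumes X: "X \<in> carrier_mat n k" and Q: "Q \<in> carrier_mat n k"
    and gap: "\<And>z. z \<in> carrier_vec k \<Longrightarrow>
      norm2_vec (X *\<^sub>v z - Q *\<^sub>v (transpose_mat Q *\<^sub>v (X *\<^sub>v z))) \<le> s * norm2_vec z"
    and s: "0 \<le> s" and x: "x \<in> carrier_vec n"
  shows "norm2_vec (transpose_mat X *\<^sub>v (x - Q *\<^sub>v (transpose_mat Q *\<^sub>v x))) \<le> s * norm2_vec x"
proof -
  let ?y = "x - Q *\<^sub>v (transpose_mat Q *\<^sub>v x)"
  let ?u = "transpose_mat X *\<^sub>v ?y"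
  have y: "?y \<in> carrier_vec n" using Q x by auto
  have u: "?u \<in> carrier_vec k" and Xu: "X *\<^sub>v ?u \<in> carrier_vec n" using X by auto
  have "norm2_vec ?u * norm2_vec ?u = ?y \<bullet> (X *\<^sub>v ?u)"
    using transpose_vec_mult_scalar[OF X u y] by (simp add: norm2_vec_sq flip: power2_eq_square)
  also have "\<dots> = x \<bullet> (X *\<^sub>v ?u - Q *\<^sub>v (transpose_mat Q *\<^sub>v (X *\<^sub>v ?u)))"
    by (rule frame_projection_self_adjoint[OF Q x Xu])
  also have "\<dots> \<le> norm2_vec x * norm2_vec (X *\<^sub>v ?u - Q *\<^sub>v (transpose_mat Q *\<^sub>v (X *\<^sub>v ?u)))"
    by (rule scalar_prod_le_norm2[OF x]) (use Q Xu in auto)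
  also have "\<dots> \<le> norm2_vec x * (s * norm2_vec ?u)"
    by (rule mult_left_mono[OF gap[OF u] norm2_vec_nonneg])
  finally have "norm2_vec ?u * norm2_vec ?u \<le> (s * norm2_vec x) * norm2_vec ?u"
    by (simp add: algebra_simps)
  then show ?thesis
    using s norm2_vec_nonneg[of x] norm2_vec_nonneg[of ?u]
    by (cases "norm2_vec ?u = 0") (auto dest!: mult_right_le_imp_le)
qed

section \<open>Spectral estimates\<close>

definition col_range :: "real mat \<Rightarrow> nat \<Rightarrow> nat \<Rightarrow> real mat" where
  "col_range V i j = mat_of_cols (dim_row V) (map (col V) [i..<j])"

lemma col_range_carrier [simp]: "V \<in> carrier_mat n m \<Longrightarrow> col_range V i j \<in> carrier_mat n (j - i)"
  by (auto simp: col_range_def)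

lemma dim_col_range [simp]: "dim_row (col_range V i j) = dim_row V" "dim_col (col_range V i j) = j - i"
  by (simp_all add: col_range_def)

lemma col_col_range: "V \<in> carrier_mat n m \<Longrightarrow> l < j - i \<Longrightarrow> col (col_range V i j) l = col V (i + l)"
  unfolding col_range_def by (subst col_mat_of_cols) auto

lemma set_cols_col_range: "set (cols (col_range V i j)) = col V ` {i..<j}"
  unfolding col_range_def by (subst cols_mat_of_cols) auto

lemma transpose_col_range_index:
  assumes "V \<in> carrier_mat n m" and "j \<le> m" and "l < j - i"
  shows "(transpose_mat (col_range V i j) *\<^sub>v x) $ l = (transpose_mat V *\<^sub>v x) $ (i + l)"
  using assms col_col_range[OF assms(1,3)] by simp

lemma frame_col_range:
  assumes V: "V \<in> carrier_mat n m" and orth: "transpose_mat V * V = 1\<^sub>m m" and "j \<le> m"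
  shows "transpose_mat (col_range V i j) * col_range V i j = 1\<^sub>m (j - i)" (is "?P = _")
proof (rule eq_matI)
  have S: "col_range V i j \<in> carrier_mat n (j - i)" using V by simp
  fix a b assume "a < dim_row (1\<^sub>m (j - i))" and "b < dim_col (1\<^sub>m (j - i))"
  then have ab: "a < j - i" "b < j - i" by auto
  then have "?P $$ (a, b) = col V (i + a) \<bullet> col V (i + b)"
    using S by (simp add: col_col_range[OF V])
  also have "\<dots> = (transpose_mat V * V) $$ (i + a, i + b)"
    using V ab \<open>j \<le> m\<close> by simp
  also have "\<dots> = 1\<^sub>m (j - i) $$ (a, b)"
    using ab \<open>j \<le> m\<close> by (simp add: orth)
  finally show "?P $$ (a, b) = 1\<^sub>m (j - i) $$ (a, b)" .
qed (use col_range_carrier[OF V, of i j] in auto)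

lemma norm2_vec_sum: "x \<in> carrier_vec n \<Longrightarrow> (norm2_vec x)\<^sup>2 = (\<Sum>i<n. (x $ i)\<^sup>2)"
  unfolding norm2_vec_sq by (simp add: scalar_prod_def power2_eq_square lessThan_atLeast0)

lemma norm2_orthogonal_transpose:
  assumes V: "V \<in> carrier_mat n n" and orth: "transpose_mat V * V = 1\<^sub>m n" and x: "x \<in> carrier_vec n"
  shows "norm2_vec (transpose_mat V *\<^sub>v x) = norm2_vec x"
proof (rule norm2_frame_mult)
  show "transpose_mat (transpose_mat V) * transpose_mat V = 1\<^sub>m n"
    using mat_mult_left_right_inverse[OF _ V orth] V by simp
qed (use V x in auto)

text \<open>In the orthonormal coordinates \<open>V\<^sup>T x\<close> the matrix \<open>A\<close> acts by multiplication with \<open>d\<close>, which turns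
norms of \<open>A x\<close> into weighted sums of squares.\<close>

lemma spectral_coordinate:
  fixes V :: "real mat"
  assumes V: "V \<in> carrier_mat n n" and orth: "transpose_mat V * V = 1\<^sub>m n"
    and A: "A = V * mat_diag n d * transpose_mat V" and x: "x \<in> carrier_vec n" and i: "i < n"
  shows "(transpose_mat V *\<^sub>v (A *\<^sub>v x)) $ i = d i * (transpose_mat V *\<^sub>v x) $ i"
proof -
  let ?c = "transpose_mat V *\<^sub>v x" and ?D = "mat_diag n d"
  have c: "?c \<in> carrier_vec n" using V by simp
  have D: "?D \<in> carrier_mat n n" by simp
  have Dc: "?D *\<^sub>v ?c \<in> carrier_vec n" using D by (rule mult_mat_vec_carrier_row)
  have "A *\<^sub>v x = V *\<^sub>v (?D *\<^sub>v ?c)"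
  proof -
    have "A *\<^sub>v x = (V * ?D) *\<^sub>v ?c"
      unfolding A by (rule assoc_mult_mat_vec[of _ n n _ n]) (use V D x in auto)
    also have "\<dots> = V *\<^sub>v (?D *\<^sub>v ?c)"
      by (rule assoc_mult_mat_vec[OF V D c])
    finally show ?thesis .
  qed
  then have "transpose_mat V *\<^sub>v (A *\<^sub>v x) = (transpose_mat V * V) *\<^sub>v (?D *\<^sub>v ?c)"
    using assoc_mult_mat_vec[of "transpose_mat V" n n V n "?D *\<^sub>v ?c"] V Dc by simp
  also have "\<dots> = ?D *\<^sub>v ?c"
    unfolding orth by (rule one_mult_mat_vec[OF Dc])
  also have "\<dots> $ i = (\<Sum>j = 0..<n. (if i = j then d j else 0) * ?c $ j)"
    using i V by (auto simp: mat_diag_def scalar_prod_def intro!: sum.cong)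
  also have "\<dots> = d i * ?c $ i"
    using i by (simp add: if_distrib[of "\<lambda>a. a * _"] cong: if_cong)
  finally show ?thesis .
qed

lemma norm2_spectral_sq:
  fixes V :: "real mat"
  assumes V: "V \<in> carrier_mat n n" and orth: "transpose_mat V * V = 1\<^sub>m n"
    and A: "A = V * mat_diag n d * transpose_mat V" and x: "x \<in> carrier_vec n"
  shows "(norm2_vec (A *\<^sub>v x))\<^sup>2 = (\<Sum>i<n. (d i)\<^sup>2 * ((transpose_mat V *\<^sub>v x) $ i)\<^sup>2)"
proof -
  have Ax: "A *\<^sub>v x \<in> carrier_vec n" using V unfolding A by (intro carrier_vecI) simp
  have "(norm2_vec (A *\<^sub>v x))\<^sup>2 = (norm2_vec (transpose_mat V *\<^sub>v (A *\<^sub>v x)))\<^sup>2"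
    using norm2_orthogonal_transpose[OF V orth Ax] by simp
  also have "\<dots> = (\<Sum>i<n. ((transpose_mat V *\<^sub>v (A *\<^sub>v x)) $ i)\<^sup>2)"
    by (rule norm2_vec_sum) (use V in simp)
  also have "\<dots> = (\<Sum>i<n. (d i)\<^sup>2 * ((transpose_mat V *\<^sub>v x) $ i)\<^sup>2)"
    by (rule sum.cong[OF refl]) (simp add: spectral_coordinate[OF V orth A x] power_mult_distrib)
  finally show ?thesis .
qed

text \<open>The head of the spectrum sees only the first \<open>k\<close> coordinates of \<open>x\<close>, which form \<open>V\<^sub>k\<^sup>T x\<close>. So
\<open>|A x|\<^sup>2 \<le> c\<^sup>2 |x|\<^sup>2 + a\<^sup>2 |V\<^sub>k\<^sup>T x|\<^sup>2\<close>, which is at most the square of the sum.\<close>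

lemma norm2_spectral_le:
  fixes V :: "real mat"
  assumes V: "V \<in> carrier_mat n n" and orth: "transpose_mat V * V = 1\<^sub>m n"
    and A: "A = V * mat_diag n d * transpose_mat V" and x: "x \<in> carrier_vec n" and k: "k \<le> n"
    and head: "\<And>i. i < k \<Longrightarrow> \<bar>d i\<bar> \<le> a" and tail: "\<And>i. k \<le> i \<Longrightarrow> i < n \<Longrightarrow> \<bar>d i\<bar> \<le> c"
    and ac: "0 \<le> a" "0 \<le> c"
  shows "norm2_vec (A *\<^sub>v x) \<le> c * norm2_vec x + a * norm2_vec (transpose_mat (col_range V 0 k) *\<^sub>v x)"
proof -
  let ?y = "transpose_mat V *\<^sub>v x" and ?z = "transpose_mat (col_range V 0 k) *\<^sub>v x"
  have "(d i)\<^sup>2 * (?y $ i)\<^sup>2 \<le> c\<^sup>2 * (?y $ i)\<^sup>2 + (if i < k then a\<^sup>2 * (?y $ i)\<^sup>2 else 0)" if "i < n" for i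
  proof (cases "i < k")
    case True
    then have "(d i)\<^sup>2 * (?y $ i)\<^sup>2 \<le> a\<^sup>2 * (?y $ i)\<^sup>2"
      using head[of i] by (intro mult_right_mono) (auto simp: abs_le_square_iff[symmetric])
    with True show ?thesis by (simp add: add_increasing)
  next
    case False
    then show ?thesis
      using tail[of i] that by (auto intro!: mult_right_mono simp: abs_le_square_iff[symmetric])
  qed
  then have "(norm2_vec (A *\<^sub>v x))\<^sup>2 \<le> (\<Sum>i<n. c\<^sup>2 * (?y $ i)\<^sup>2 + (if i < k then a\<^sup>2 * (?y $ i)\<^sup>2 else 0))"
    unfolding norm2_spectral_sq[OF V orth A x] by (intro sum_mono) simp
  also have "\<dots> = c\<^sup>2 * (\<Sum>i<n. (?y $ i)\<^sup>2) + a\<^sup>2 * (\<Sum>i<k. (?y $ i)\<^sup>2)"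
  proof -
    have "{..<n} \<inter> {i. i < k} = {..<k}" using k by auto
    then show ?thesis
      by (simp add: sum.distrib sum_distrib_left sum.If_cases)
  qed
  also have "(\<Sum>i<n. (?y $ i)\<^sup>2) = (norm2_vec x)\<^sup>2"
    using norm2_vec_sum[of ?y n] norm2_orthogonal_transpose[OF V orth x] V by simp
  also have "(\<Sum>i<k. (?y $ i)\<^sup>2) = (norm2_vec ?z)\<^sup>2"
  proof -
    have "?z \<in> carrier_vec k"
      using transpose_mult_mat_vec_carrier[OF col_range_carrier[OF V, of 0 k]] by simp
    moreover have "?z $ i = ?y $ i" if "i < k" for i
      using transpose_col_range_index[OF V k, of i 0 x] that by (simp del: index_mult_mat_vec)
    ultimately show ?thesis
      by (simp add: norm2_vec_sum del: index_mult_mat_vec)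
  qed
  also have "c\<^sup>2 * (norm2_vec x)\<^sup>2 + a\<^sup>2 * (norm2_vec ?z)\<^sup>2 \<le> (c * norm2_vec x + a * norm2_vec ?z)\<^sup>2"
    using ac norm2_vec_nonneg[of x] norm2_vec_nonneg[of ?z] by (simp add: power2_sum power_mult_distrib)
  finally show ?thesis
    by (rule power2_le_imp_le) (use ac norm2_vec_nonneg in simp)
qed

text \<open>Padding the list with zero rows yields a square matrix whose transpose kills the last unit vector, so its
determinant vanishes.\<close>

lemma ex_nonzero_orthogonal:
  fixes ws :: "real vec list"
  assumes ws: "set ws \<subseteq> carrier_vec n" and len: "length ws < n"
  shows "\<exists>x \<in> carrier_vec n. x \<noteq> 0\<^sub>v n \<and> (\<forall>w \<in> set ws. w \<bullet> x = 0)"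
proof -
  let ?rs = "ws @ replicate (n - length ws) (0\<^sub>v n)"
  let ?W = "mat_of_rows n ?rs"
  have lrs: "length ?rs = n" using len by simp
  have W: "?W \<in> carrier_mat n n" using mat_of_rows_carrier(1)[of n ?rs] unfolding lrs .
  have rs: "set ?rs \<subseteq> carrier_vec n" using ws by auto
  have row: "row ?W i = ?rs ! i" if "i < n" for i
  proof (rule mat_of_rows_row)
    show "i < length ?rs" using that lrs by simp
    then show "?rs ! i \<in> carrier_vec n" using rs nth_mem by blast
  qed
  have "transpose_mat ?W *\<^sub>v unit_vec n (n - 1) = 0\<^sub>v n"
  proof (rule eq_vecI)
    fix i assume "i < dim_vec (0\<^sub>v n :: real vec)"
    then have i: "i < n" by simp
    have "(transpose_mat ?W *\<^sub>v unit_vec n (n - 1)) $ i = col ?W i $ (n - 1)"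
      using i W by (auto simp: scalar_prod_right_unit)
    also have "\<dots> = row ?W (n - 1) $ i"
      using i W by auto
    also have "\<dots> = 0"
      using row[of "n - 1"] len i by (simp add: nth_append)
    finally show "(transpose_mat ?W *\<^sub>v unit_vec n (n - 1)) $ i = (0\<^sub>v n) $ i" using i by simp
  qed (use W in auto)
  moreover have "unit_vec n (n - 1) \<noteq> (0\<^sub>v n :: real vec)"
    using len by (auto simp: vec_eq_iff intro!: exI[of _ "n - 1"])
  ultimately have "\<exists>v. v \<in> carrier_vec n \<and> v \<noteq> 0\<^sub>v n \<and> transpose_mat ?W *\<^sub>v v = 0\<^sub>v n"
    by (intro exI[of _ "unit_vec n (n - 1)"] conjI unit_vec_carrier)
  moreover have "transpose_mat ?W \<in> carrier_mat n n" using W by simp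
  ultimately have "det (transpose_mat ?W) = 0"
    by (rule iffD2[OF det_0_iff_vec_prod_zero_field, rotated])
  then have "det ?W = 0" unfolding det_transpose[OF W] .
  then obtain x where x: "x \<in> carrier_vec n" "x \<noteq> 0\<^sub>v n" "?W *\<^sub>v x = 0\<^sub>v n"
    using det_0_iff_vec_prod_zero_field[OF W] by blast
  have "w \<bullet> x = 0" if in_ws: "w \<in> set ws" for w
  proof -
    obtain i where i: "i < length ws" and w: "ws ! i = w"
      using in_ws unfolding in_set_conv_nth by blast
    then have "row ?W i = w"
      using len row[of i] by (simp add: nth_append)
    moreover have "(?W *\<^sub>v x) $ i = row ?W i \<bullet> x"
      by (rule index_mult_mat_vec) (use W i len in auto)
    ultimately show ?thesis using x(3) i len by simp
  qed
  with x(1,2) show ?thesis by blast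
qed

text \<open>Together, the \<open>k\<close> equations \<open>Q\<^sup>T x = 0\<close> and the \<open>n - k - 1\<close> equations that kill the components of
\<open>x\<close> along the eigenvectors with index above \<open>k\<close> (counted from 0) leave a nonzero solution \<open>x\<close>. There
\<open>M x = A x\<close>, and \<open>A\<close> stretches \<open>x\<close> by at least \<open>c\<close>. This is the lower bound in the Eckart-Young
theorem.\<close>

lemma norm2_mat_ge_of_agree_on_kernel:
  fixes V :: "real mat"
  assumes V: "V \<in> carrier_mat n n" and orth: "transpose_mat V * V = 1\<^sub>m n"
    and A: "A = V * mat_diag n d * transpose_mat V"
    and M: "M \<in> carrier_mat n n" and Q: "Q \<in> carrier_mat n k" and k: "k < n"
    and agree: "\<And>x. x \<in> carrier_vec n \<Longrightarrow> transpose_mat Q *\<^sub>v x = 0\<^sub>v k \<Longrightarrow> M *\<^sub>v x = A *\<^sub>v x"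
    and head: "\<And>i. i \<le> k \<Longrightarrow> c \<le> \<bar>d i\<bar>" and c: "0 \<le> c"
  shows "c \<le> norm2_mat M"
proof -
  let ?ws = "cols Q @ cols (col_range V (k + 1) n)"
  have "set ?ws \<subseteq> carrier_vec n"
    using cols_dim[of Q] Q V unfolding set_append set_cols_col_range by auto
  moreover have "length ?ws < n" using Q V col_range_carrier[OF V, of "k + 1" n] k by auto
  ultimately obtain x where x: "x \<in> carrier_vec n" "x \<noteq> 0\<^sub>v n"
    and wx: "\<And>w. w \<in> set ?ws \<Longrightarrow> w \<bullet> x = 0"
    using ex_nonzero_orthogonal by metis
  have Qx: "w \<bullet> x = 0" if "w \<in> set (cols Q)" for w
    using wx that by simp
  have Vx: "col V i \<bullet> x = 0" if "k + 1 \<le> i" "i < n" for i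
    using wx[of "col V i"] that unfolding set_append set_cols_col_range by simp
  have "transpose_mat Q *\<^sub>v x = 0\<^sub>v k"
  proof (rule eq_vecI)
    fix i assume "i < dim_vec (0\<^sub>v k :: real vec)"
    then have "i < dim_col Q" using Q by simp
    moreover from this have "col Q i \<in> set (cols Q)" by (auto simp: cols_def)
    ultimately show "(transpose_mat Q *\<^sub>v x) $ i = 0\<^sub>v k $ i"
      using Qx Q by simp
  qed (use Q in simp)
  then have Mx: "M *\<^sub>v x = A *\<^sub>v x" using agree x(1) by blast
  let ?y = "transpose_mat V *\<^sub>v x"
  have "(c * norm2_vec x)\<^sup>2 = (\<Sum>i<n. c\<^sup>2 * (?y $ i)\<^sup>2)"
    using norm2_vec_sum[of ?y n] norm2_orthogonal_transpose[OF V orth x(1)] V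
    by (simp add: power_mult_distrib sum_distrib_left)
  also have "\<dots> \<le> (\<Sum>i<n. (d i)\<^sup>2 * (?y $ i)\<^sup>2)"
  proof (rule sum_mono)
    fix i assume i: "i \<in> {..<n}"
    show "c\<^sup>2 * (?y $ i)\<^sup>2 \<le> (d i)\<^sup>2 * (?y $ i)\<^sup>2"
    proof (cases "i \<le> k")
      case True
      then show ?thesis
        using head[of i] c by (intro mult_right_mono) (auto simp: abs_le_square_iff[symmetric])
    next
      case False
      then have "?y $ i = 0" using Vx[of i] i V by simp
      then show ?thesis by simp
    qed
  qed
  also have "\<dots> = (norm2_vec (M *\<^sub>v x))\<^sup>2"
    unfolding Mx norm2_spectral_sq[OF V orth A x(1)] ..
  finally have "c * norm2_vec x \<le> norm2_vec (M *\<^sub>v x)"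
    by (rule power2_le_imp_le) (rule norm2_vec_nonneg)
  also have "\<dots> \<le> norm2_mat M * norm2_vec x"
    by (rule norm2_mult_mat_vec_le[OF M x(1)])
  finally show ?thesis
    using norm2_vec_eq_0_iff[OF x(1)] x(2) norm2_vec_nonneg[of x] by (auto dest!: mult_right_le_imp_le)
qed

section \<open>Canonical angles\<close>

lemma minus_mult_mat_vec_zero:
  fixes X :: "real mat"
  assumes X: "X \<in> carrier_mat n k" and v: "v \<in> carrier_vec n"
  shows "v - X *\<^sub>v 0\<^sub>v k = v"
proof (rule eq_vecI)
  fix i assume "i < dim_vec v"
  then have i: "i < n" using v by simp
  then have "(X *\<^sub>v 0\<^sub>v k) $ i = 0"
    using X by (simp add: scalar_prod_def)
  then show "(v - X *\<^sub>v 0\<^sub>v k) $ i = v $ i"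
    using X i by (simp del: index_mult_mat_vec)
qed (use X v in auto)

lemma span_cols_iff:
  assumes B: "B \<in> carrier_mat n m"
  shows "y \<in> span_vec n (set (cols B)) \<longleftrightarrow> (\<exists>c \<in> carrier_vec m. y = B *\<^sub>v c)"
proof -
  interpret vec_space "TYPE(real)" n .
  have "y \<in> span (set (cols B)) \<longleftrightarrow> y \<in> carrier_vec n \<and> (\<exists>c \<in> carrier_vec m. B *\<^sub>v c = y)"
    using col_space_eq[OF B] B unfolding col_space_def by auto
  then show ?thesis
    using mult_mat_vec_carrier_row[OF B] by metis
qed

lemma orthogonal_complement_span_cols:
  assumes B: "(B :: real mat) \<in> carrier_mat n m"
  shows "y \<in> vec_module.orthogonal_complement n (span_vec n (set (cols B)))
    \<longleftrightarrow> y \<in> carrier_vec n \<and> transpose_mat B *\<^sub>v y = 0\<^sub>v m"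
proof -
  interpret vec_space "TYPE(real)" n .
  have sub: "set (cols B) \<subseteq> carrier_vec n" using cols_dim[of B] B by simp
  have cols: "set (cols B) = col B ` {..<m}" using B by (auto simp: cols_def)
  have "y \<in> orthogonal_complement (span (set (cols B)))
    \<longleftrightarrow> y \<in> carrier_vec n \<and> (\<forall>w \<in> set (cols B). y \<bullet> w = 0)"
    unfolding in_orthogonal_complement_span[OF sub] by (simp add: orthogonal_complement_def)
  also have "\<dots> \<longleftrightarrow> y \<in> carrier_vec n \<and> (\<forall>i<m. y \<bullet> col B i = 0)"
    unfolding cols by auto
  also have "\<dots> \<longleftrightarrow> y \<in> carrier_vec n \<and> transpose_mat B *\<^sub>v y = 0\<^sub>v m"
  proof -
    have "(transpose_mat B *\<^sub>v y) $ i = y \<bullet> col B i" if "i < m" "y \<in> carrier_vec n" for i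
      using that B comm_scalar_prod[of y n "col B i"] by simp
    moreover have "dim_vec (transpose_mat B *\<^sub>v y) = m" using B by simp
    ultimately show ?thesis by (auto simp: vec_eq_iff simp del: index_mult_mat_vec)
  qed
  finally show ?thesis .
qed

lemma frame_residual_orthogonal:
  fixes X :: "real mat"
  assumes X: "X \<in> carrier_mat n k" and orth: "transpose_mat X * X = 1\<^sub>m k" and y: "y \<in> carrier_vec n"
  shows "transpose_mat X *\<^sub>v (y - X *\<^sub>v (transpose_mat X *\<^sub>v y)) = 0\<^sub>v k"
proof -
  have c: "transpose_mat X *\<^sub>v y \<in> carrier_vec k" using X by simp
  have "transpose_mat X *\<^sub>v (X *\<^sub>v (transpose_mat X *\<^sub>v y)) = transpose_mat X *\<^sub>v y"
    by (rule transpose_frame_mult[OF X orth c])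
  then show ?thesis
    using mult_minus_distrib_mat_vec[of "transpose_mat X" k n y "X *\<^sub>v (transpose_mat X *\<^sub>v y)"] X y c
    by simp
qed

text \<open>The residual \<open>r = y - X X\<^sup>T y\<close> lies in the orthogonal complement of \<open>range X\<close>, so \<open>r = X\<^sub>p c\<close> for
any orthonormal basis \<open>X\<^sub>p\<close> of the complement, with \<open>|c| = |r|\<close>. Then
\<open>|r|\<^sup>2 = y \<bullet> r = X\<^sub>p\<^sup>T y \<bullet> c \<le> |X\<^sub>p\<^sup>T y| |r|\<close>.\<close>

lemma norm2_residual_le_complement:
  assumes X: "X \<in> carrier_mat n k" "transpose_mat X * X = 1\<^sub>m k"
    and Xp: "orthonormal_basis_mat n Xp
      (vec_module.orthogonal_complement n (span_vec n (set (cols X))))"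
    and y: "y \<in> carrier_vec n"
  shows "norm2_vec (y - X *\<^sub>v (transpose_mat X *\<^sub>v y)) \<le> norm2_vec (transpose_mat Xp *\<^sub>v y)"
proof -
  let ?r = "y - X *\<^sub>v (transpose_mat X *\<^sub>v y)" and ?m = "dim_col Xp"
  have Xp': "Xp \<in> carrier_mat n ?m" "transpose_mat Xp * Xp = 1\<^sub>m ?m"
    and span: "span_vec n (set (cols Xp)) = vec_module.orthogonal_complement n (span_vec n (set (cols X)))"
    using Xp by (auto simp: orthonormal_basis_mat_def)
  have r: "?r \<in> carrier_vec n" using X y by simp
  have orth: "transpose_mat X *\<^sub>v ?r = 0\<^sub>v k" by (rule frame_residual_orthogonal[OF X y])
  have "?r \<in> span_vec n (set (cols Xp))"
    unfolding span orthogonal_complement_span_cols[OF X(1)] using r orth by simp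
  then obtain c where c: "c \<in> carrier_vec ?m" and rc: "?r = Xp *\<^sub>v c"
    unfolding span_cols_iff[OF Xp'(1)] by blast
  have nc: "norm2_vec c = norm2_vec ?r"
    unfolding rc by (rule norm2_frame_mult[OF Xp' c, symmetric])
  have "norm2_vec ?r * norm2_vec ?r = ?r \<bullet> ?r"
    by (simp add: norm2_vec_sq flip: power2_eq_square)
  also have "\<dots> = y \<bullet> (?r - X *\<^sub>v (transpose_mat X *\<^sub>v ?r))"
    by (rule frame_projection_self_adjoint[OF X(1) y r])
  also have "\<dots> = y \<bullet> ?r"
  proof -
    have "?r - X *\<^sub>v 0\<^sub>v k = ?r" by (rule minus_mult_mat_vec_zero[OF X(1) r])
    then show ?thesis unfolding orth by (rule arg_cong[where f = "scalar_prod y"])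
  qed
  also have "\<dots> = (transpose_mat Xp *\<^sub>v y) \<bullet> c"
    using transpose_vec_mult_scalar[OF Xp'(1) c y] rc by metis
  also have "\<dots> \<le> norm2_vec (transpose_mat Xp *\<^sub>v y) * norm2_vec c"
    by (rule scalar_prod_le_norm2[OF transpose_mult_mat_vec_carrier[OF Xp'(1)] c])
  finally have "norm2_vec ?r * norm2_vec ?r \<le> norm2_vec (transpose_mat Xp *\<^sub>v y) * norm2_vec ?r"
    unfolding nc .
  then show ?thesis
    using norm2_vec_nonneg[of ?r] norm2_vec_nonneg[of "transpose_mat Xp *\<^sub>v y"]
    by (cases "norm2_vec ?r = 0") (auto dest!: mult_right_le_imp_le)
qed

text \<open>\<^const>\<open>norm_sin_Theta\<close> is a choice over orthonormal bases, so it has meaning only when such bases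
exist. For a span of leading eigenvectors the remaining eigenvectors supply one of the complement.\<close>

lemma orthonormal_basis_mat_complement:
  assumes V: "V \<in> carrier_mat n n" and orth: "transpose_mat V * V = 1\<^sub>m n" and k: "k \<le> n"
  shows "orthonormal_basis_mat n (col_range V k n)
    (vec_module.orthogonal_complement n (span_vec n (set (cols (col_range V 0 k)))))"
proof -
  let ?H = "col_range V 0 k" and ?B = "col_range V k n"
  have H: "?H \<in> carrier_mat n k" "transpose_mat ?H * ?H = 1\<^sub>m k"
    using col_range_carrier[OF V, of 0 k] frame_col_range[OF V orth k, of 0] by simp_all
  have B: "?B \<in> carrier_mat n (n - k)" "transpose_mat ?B * ?B = 1\<^sub>m (n - k)"
    using col_range_carrier[OF V, of k n] frame_col_range[OF V orth order_refl, of k] by simp_all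
  have Hi: "(transpose_mat ?H *\<^sub>v y) $ i = (transpose_mat V *\<^sub>v y) $ i" if "i < k" for y i
    using transpose_col_range_index[OF V k, of i 0 y] that by (simp del: index_mult_mat_vec)
  have Bi: "(transpose_mat ?B *\<^sub>v y) $ i = (transpose_mat V *\<^sub>v y) $ (k + i)" if "i < n - k" for y i
    by (rule transpose_col_range_index[OF V order_refl that])
  have sum_split: "(norm2_vec y)\<^sup>2 = (norm2_vec (transpose_mat ?H *\<^sub>v y))\<^sup>2 + (norm2_vec (transpose_mat ?B *\<^sub>v y))\<^sup>2"
    if y: "y \<in> carrier_vec n" for y
  proof -
    have "(norm2_vec y)\<^sup>2 = (\<Sum>i<n. ((transpose_mat V *\<^sub>v y) $ i)\<^sup>2)"
      using norm2_vec_sum[of "transpose_mat V *\<^sub>v y" n] norm2_orthogonal_transpose[OF V orth y] V by simp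
    also have "\<dots> = (\<Sum>i<k. ((transpose_mat V *\<^sub>v y) $ i)\<^sup>2) + (\<Sum>i<n - k. ((transpose_mat V *\<^sub>v y) $ (k + i))\<^sup>2)"
      using sum.atLeastLessThan_concat[of 0 k n "\<lambda>i. ((transpose_mat V *\<^sub>v y) $ i)\<^sup>2"] k
        sum.shift_bounds_nat_ivl[of "\<lambda>i. ((transpose_mat V *\<^sub>v y) $ i)\<^sup>2" 0 k "n - k"]
      by (simp add: lessThan_atLeast0 add.commute del: index_mult_mat_vec)
    also have "\<dots> = (norm2_vec (transpose_mat ?H *\<^sub>v y))\<^sup>2 + (norm2_vec (transpose_mat ?B *\<^sub>v y))\<^sup>2"
      using transpose_mult_mat_vec_carrier[OF H(1), of y] transpose_mult_mat_vec_carrier[OF B(1), of y]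
      by (simp add: norm2_vec_sum Hi Bi del: index_mult_mat_vec)
    finally show ?thesis .
  qed
  have "span_vec n (set (cols ?B)) = vec_module.orthogonal_complement n (span_vec n (set (cols ?H)))"
  proof (intro Set.set_eqI iffI)
    fix y assume "y \<in> span_vec n (set (cols ?B))"
    then obtain c where c: "c \<in> carrier_vec (n - k)" and y: "y = ?B *\<^sub>v c"
      unfolding span_cols_iff[OF B(1)] by blast
    have yc: "y \<in> carrier_vec n" using y B by simp
    have "transpose_mat ?B *\<^sub>v y = c"
      unfolding y by (rule transpose_frame_mult[OF B c])
    then have "(norm2_vec (transpose_mat ?H *\<^sub>v y))\<^sup>2 = 0"
      using sum_split[OF yc] norm2_frame_mult[OF B c] y by simp
    then have "transpose_mat ?H *\<^sub>v y = 0\<^sub>v k"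
      using norm2_vec_eq_0_iff[OF transpose_mult_mat_vec_carrier[OF H(1)], of y] by simp
    then show "y \<in> vec_module.orthogonal_complement n (span_vec n (set (cols ?H)))"
      unfolding orthogonal_complement_span_cols[OF H(1)] using yc by simp
  next
    fix y assume "y \<in> vec_module.orthogonal_complement n (span_vec n (set (cols ?H)))"
    then have y: "y \<in> carrier_vec n" and "transpose_mat ?H *\<^sub>v y = 0\<^sub>v k"
      unfolding orthogonal_complement_span_cols[OF H(1)] by auto
    then have "(norm2_vec (y - ?B *\<^sub>v (transpose_mat ?B *\<^sub>v y)))\<^sup>2 = 0"
      using frame_residual_sq[OF B y] sum_split[OF y] norm2_vec_eq_0_iff[of "0\<^sub>v k" k] by simp
    moreover have By: "?B *\<^sub>v (transpose_mat ?B *\<^sub>v y) \<in> carrier_vec n" using B by simp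
    ultimately have r: "y - ?B *\<^sub>v (transpose_mat ?B *\<^sub>v y) = 0\<^sub>v n"
      using norm2_vec_eq_0_iff[OF minus_carrier_vec[OF y By]] by simp
    have "y = ?B *\<^sub>v (transpose_mat ?B *\<^sub>v y)"
    proof (rule eq_vecI)
      fix i assume "i < dim_vec (?B *\<^sub>v (transpose_mat ?B *\<^sub>v y))"
      then have i: "i < n" using V by simp
      have "(y - ?B *\<^sub>v (transpose_mat ?B *\<^sub>v y)) $ i = 0" unfolding r using i by simp
      then show "y $ i = (?B *\<^sub>v (transpose_mat ?B *\<^sub>v y)) $ i"
        using i y V by (simp del: index_mult_mat_vec)
    qed (use y V in auto)
    then show "y \<in> span_vec n (set (cols ?B))"
      unfolding span_cols_iff[OF B(1)] using transpose_mult_mat_vec_carrier[OF B(1)] by blast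
  qed
  then show ?thesis
    unfolding orthonormal_basis_mat_def using B V by simp
qed

text \<open>Whichever bases \<open>X\<^sub>p\<close> and \<open>Y'\<close> are chosen, a vector \<open>Q u\<close> can be rewritten as \<open>Y' w\<close> with
\<open>|w| = |u|\<close>, and its residual against \<open>X\<close> is bounded by \<open>|X\<^sub>p\<^sup>T Y' w|\<close>. The bases \<open>Z\<close> and \<open>Q\<close>
show that there is something to choose from.\<close>

lemma norm_sin_Theta_gap:
  assumes X: "X \<in> carrier_mat n k" "transpose_mat X * X = 1\<^sub>m k"
    and Q: "Q \<in> carrier_mat n m" "transpose_mat Q * Q = 1\<^sub>m m"
    and ex: "orthonormal_basis_mat n Z (vec_module.orthogonal_complement n (span_vec n (set (cols X))))"
  defines "s \<equiv> norm_sin_Theta n (span_vec n (set (cols X))) (span_vec n (set (cols Q)))"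
  shows "0 \<le> s"
    and "u \<in> carrier_vec m \<Longrightarrow> norm2_vec (Q *\<^sub>v u - X *\<^sub>v (transpose_mat X *\<^sub>v (Q *\<^sub>v u))) \<le> s * norm2_vec u"
proof -
  have "orthonormal_basis_mat n Q (span_vec n (set (cols Q)))"
    using Q by (simp add: orthonormal_basis_mat_def)
  with ex have "\<exists>s Xp Y'. orthonormal_basis_mat n Xp (vec_module.orthogonal_complement n (span_vec n (set (cols X)))) \<and>
     orthonormal_basis_mat n Y' (span_vec n (set (cols Q))) \<and> s = norm2_mat (transpose_mat Xp * Y')"
    by blast
  from someI_ex[OF this] obtain Xp Y' where
    Xp: "orthonormal_basis_mat n Xp (vec_module.orthogonal_complement n (span_vec n (set (cols X))))"
    and Y': "orthonormal_basis_mat n Y' (span_vec n (set (cols Q)))"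
    and s: "s = norm2_mat (transpose_mat Xp * Y')"
    unfolding s_def norm_sin_Theta_def by blast
  show "0 \<le> s" unfolding s by (rule norm2_mat_nonneg)
  assume u: "u \<in> carrier_vec m"
  have Y: "Y' \<in> carrier_mat n (dim_col Y')" "transpose_mat Y' * Y' = 1\<^sub>m (dim_col Y')"
    and span: "span_vec n (set (cols Y')) = span_vec n (set (cols Q))"
    using Y' by (auto simp: orthonormal_basis_mat_def)
  have XpC: "transpose_mat Xp \<in> carrier_mat (dim_col Xp) n"
    using Xp by (auto simp: orthonormal_basis_mat_def)
  have Qu: "Q *\<^sub>v u \<in> carrier_vec n" using Q by simp
  have "Q *\<^sub>v u \<in> span_vec n (set (cols Y'))"
    unfolding span span_cols_iff[OF Q(1)] using u by blast
  then obtain w where w: "w \<in> carrier_vec (dim_col Y')" and Quw: "Q *\<^sub>v u = Y' *\<^sub>v w"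
    unfolding span_cols_iff[OF Y(1)] by blast
  have nw: "norm2_vec w = norm2_vec u"
    using norm2_frame_mult[OF Y w] norm2_frame_mult[OF Q u] Quw by simp
  have "norm2_vec (Q *\<^sub>v u - X *\<^sub>v (transpose_mat X *\<^sub>v (Q *\<^sub>v u))) \<le> norm2_vec (transpose_mat Xp *\<^sub>v (Q *\<^sub>v u))"
    by (rule norm2_residual_le_complement[OF X Xp Qu])
  also have "transpose_mat Xp *\<^sub>v (Q *\<^sub>v u) = (transpose_mat Xp * Y') *\<^sub>v w"
    unfolding Quw by (rule assoc_mult_mat_vec[OF XpC Y(1) w, symmetric])
  also have "norm2_vec \<dots> \<le> s * norm2_vec w"
    unfolding s by (rule norm2_mult_mat_vec_le[OF mult_carrier_mat[OF XpC Y(1)] w])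
  finally show "norm2_vec (Q *\<^sub>v u - X *\<^sub>v (transpose_mat X *\<^sub>v (Q *\<^sub>v u))) \<le> s * norm2_vec u"
    unfolding nw .
qed

section \<open>Spans and Krylov vectors\<close>

lemma span_vec_superset: "S \<subseteq> carrier_vec n \<Longrightarrow> x \<in> S \<Longrightarrow> x \<in> span_vec n S"
proof -
  interpret vec_space "TYPE(real)" n .
  show "S \<subseteq> carrier_vec n \<Longrightarrow> x \<in> S \<Longrightarrow> x \<in> span_vec n S"
    using in_own_span by blast
qed

lemma span_vec_smult:
  assumes "S \<subseteq> carrier_vec n" and "x \<in> span_vec n S"
  shows "c \<cdot>\<^sub>v x \<in> span_vec n S"
proof -
  interpret vec_space "TYPE(real)" n .
  show ?thesis by (rule smult_in_span[OF assms])
qed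

lemma span_vec_lin:
  assumes "S \<subseteq> carrier_vec n" and "x \<in> span_vec n S" and "y \<in> span_vec n S"
  shows "c \<cdot>\<^sub>v x + d \<cdot>\<^sub>v y \<in> span_vec n S"
proof -
  interpret vec_space "TYPE(real)" n .
  show ?thesis
    by (rule span_add1[OF assms(1)]) (intro smult_in_span assms)+
qed

lemma span_vec_mono: "S \<subseteq> T \<Longrightarrow> span_vec n S \<subseteq> span_vec n T"
proof -
  interpret vec_space "TYPE(real)" n .
  show "S \<subseteq> T \<Longrightarrow> span_vec n S \<subseteq> span_vec n T" by (rule span_is_monotone)
qed

lemma span_vec_zero: "0\<^sub>v n \<in> span_vec n S"
proof -
  interpret vec_space "TYPE(real)" n .
  show ?thesis by (rule span_zero)
qed

lemma span_vec_minimal: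
  assumes "S \<subseteq> span_vec n T" and "T \<subseteq> carrier_vec n"
  shows "span_vec n S \<subseteq> span_vec n T"
proof -
  interpret vec_space "TYPE(real)" n .
  show ?thesis by (rule span_subsetI[OF assms(2,1)])
qed

text \<open>The vectors that \<open>A\<close> sends into a fixed span form a submodule, so it is enough to test generators.\<close>

lemma mult_mat_vec_span:
  fixes A :: "real mat"
  assumes A: "A \<in> carrier_mat n n" and S: "S \<subseteq> carrier_vec n" and T: "T \<subseteq> carrier_vec n"
    and gen: "\<And>s. s \<in> S \<Longrightarrow> A *\<^sub>v s \<in> span_vec n T" and x: "x \<in> span_vec n S"
  shows "A *\<^sub>v x \<in> span_vec n T"
proof -
  interpret vec_space "TYPE(real)" n .
  let ?W = "{x \<in> carrier_vec n. A *\<^sub>v x \<in> span T}"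
  have A0: "A *\<^sub>v 0\<^sub>v n = 0\<^sub>v n" using A by (intro eq_vecI) auto
  have "submodule class_ring ?W V"
  proof (unfold_locales, goal_cases)
    case 1 then show ?case by auto
  next
    case (2 v w)
    then have "A *\<^sub>v (v + w) = A *\<^sub>v v + A *\<^sub>v w" using A by (auto intro: mult_add_distrib_mat_vec)
    with 2 show ?case using span_add1[OF T] by (auto simp: module_vec_simps)
  next
    case 3
    show ?case using A0 span_zero by (auto simp: module_vec_simps)
  next
    case (4 c v)
    then have "A *\<^sub>v (c \<cdot>\<^sub>v v) = c \<cdot>\<^sub>v (A *\<^sub>v v)" using A by (auto simp: mult_mat_vec)
    with 4 show ?case using smult_in_span[OF T] by (auto simp: module_vec_simps)
  qed
  moreover have "S \<subseteq> ?W" using S gen by auto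
  ultimately have "span S \<subseteq> ?W" by (rule span_is_subset[rotated])
  then show ?thesis using x by blast
qed

lemma pow_mat_mult_vec_Suc:
  fixes A :: "real mat"
  assumes A: "A \<in> carrier_mat n n" and w: "w \<in> carrier_vec n"
  shows "(A ^\<^sub>m Suc i) *\<^sub>v w = A *\<^sub>v ((A ^\<^sub>m i) *\<^sub>v w)"
  using w
proof (induction i arbitrary: w)
  case 0
  have "(A ^\<^sub>m Suc 0) *\<^sub>v w = A *\<^sub>v w" using A by simp
  moreover have "(A ^\<^sub>m 0) *\<^sub>v w = w" using A 0 by simp
  ultimately show ?case by simp
next
  case (Suc i)
  have pow: "A ^\<^sub>m j \<in> carrier_mat n n" for j using A by simp
  have step: "(A ^\<^sub>m Suc j) *\<^sub>v w = (A ^\<^sub>m j) *\<^sub>v (A *\<^sub>v w)" for j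
    using assoc_mult_mat_vec[OF pow A Suc.prems] by simp
  have "A *\<^sub>v w \<in> carrier_vec n" using A Suc.prems by simp
  from Suc.IH[OF this] show ?case unfolding step .
qed

section \<open>The symmetric Lanczos process\<close>

lemma lanczos_state_unfold:
  "lanczos_state n A w j = (lanczos_q n A w j, lanczos_\<beta> n A w j, lanczos_q n A w (Suc j))"
  by (cases "lanczos_state n A w j") (simp add: lanczos_q_def lanczos_\<beta>_def Let_def)

lemma lanczos_q_0: "lanczos_q n A w 0 = 0\<^sub>v n"
  and lanczos_\<beta>_0: "lanczos_\<beta> n A w 0 = 0"
  by (simp_all add: lanczos_q_def lanczos_\<beta>_def)

lemma lanczos_q_1: "lanczos_q n A w (Suc 0) = (1 / norm2_vec w) \<cdot>\<^sub>v w"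
  by (simp add: lanczos_q_def Let_def)

definition lanczos_residual :: "nat \<Rightarrow> real mat \<Rightarrow> real vec \<Rightarrow> nat \<Rightarrow> real vec" where
  "lanczos_residual n A w j = A *\<^sub>v lanczos_q n A w (Suc j)
     - lanczos_\<alpha> n A w (Suc j) \<cdot>\<^sub>v lanczos_q n A w (Suc j) - lanczos_\<beta> n A w j \<cdot>\<^sub>v lanczos_q n A w j"

lemma lanczos_\<beta>_Suc: "lanczos_\<beta> n A w (Suc j) = norm2_vec (lanczos_residual n A w j)"
  and lanczos_q_Suc_Suc: "lanczos_q n A w (Suc (Suc j)) =
    (1 / lanczos_\<beta> n A w (Suc j)) \<cdot>\<^sub>v lanczos_residual n A w j"
proof -
  have "lanczos_state n A w (Suc j) = (lanczos_q n A w (Suc j), norm2_vec (lanczos_residual n A w j),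
     (1 / norm2_vec (lanczos_residual n A w j)) \<cdot>\<^sub>v lanczos_residual n A w j)"
    by (simp add: lanczos_state_unfold[of n A w j] Let_def lanczos_residual_def lanczos_\<alpha>_def)
  then show 1: "lanczos_\<beta> n A w (Suc j) = norm2_vec (lanczos_residual n A w j)"
    and "lanczos_q n A w (Suc (Suc j)) = (1 / lanczos_\<beta> n A w (Suc j)) \<cdot>\<^sub>v lanczos_residual n A w j"
    unfolding lanczos_state_unfold by auto
qed

lemma lanczos_carrier:
  assumes A: "A \<in> carrier_mat n n" and w: "w \<in> carrier_vec n"
  shows lanczos_q_carrier: "lanczos_q n A w j \<in> carrier_vec n"
    and lanczos_residual_carrier: "lanczos_residual n A w j \<in> carrier_vec n"
proof -
  have "lanczos_q n A w j \<in> carrier_vec n \<and> lanczos_q n A w (Suc j) \<in> carrier_vec n" for j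
  proof (induction j)
    case 0
    then show ?case using w by (simp add: lanczos_q_0 lanczos_q_1)
  next
    case (Suc j)
    then have "lanczos_residual n A w j \<in> carrier_vec n"
      using A by (simp add: lanczos_residual_def)
    with Suc show ?case by (simp add: lanczos_q_Suc_Suc)
  qed
  then show "lanczos_q n A w j \<in> carrier_vec n" and "lanczos_residual n A w j \<in> carrier_vec n"
    using A by (simp_all add: lanczos_residual_def)
qed

text \<open>At a breakdown \<open>\<beta>\<close> vanishes and so does the residual, so the three-term recurrence and
\<open>A Q\<^sub>k = Q\<^sub>k\<^sub>+\<^sub>1 T\<^sub>k\<close> survive it.\<close>

lemma lanczos_residual_normalized:
  assumes A: "A \<in> carrier_mat n n" and w: "w \<in> carrier_vec n"
  shows "lanczos_\<beta> n A w (Suc j) \<cdot>\<^sub>v lanczos_q n A w (Suc (Suc j)) = lanczos_residual n A w j"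
proof (cases "lanczos_\<beta> n A w (Suc j) = 0")
  case True
  then have "lanczos_residual n A w j = 0\<^sub>v n"
    using norm2_vec_eq_0_iff[OF lanczos_residual_carrier[OF A w]] by (simp add: lanczos_\<beta>_Suc)
  with True show ?thesis
    using lanczos_q_carrier[OF A w, of "Suc (Suc j)"] by (auto simp: vec_eq_iff)
next
  case False
  then show ?thesis by (simp add: lanczos_q_Suc_Suc smult_smult_assoc)
qed

lemma lanczos_three_term:
  assumes A: "A \<in> carrier_mat n n" and w: "w \<in> carrier_vec n" and a: "a < n"
  shows "(A *\<^sub>v lanczos_q n A w (Suc j)) $ a =
    lanczos_\<beta> n A w (Suc j) * lanczos_q n A w (Suc (Suc j)) $ a
      + lanczos_\<alpha> n A w (Suc j) * lanczos_q n A w (Suc j) $ a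
      + lanczos_\<beta> n A w j * lanczos_q n A w j $ a"
proof -
  have "lanczos_\<beta> n A w (Suc j) * lanczos_q n A w (Suc (Suc j)) $ a = lanczos_residual n A w j $ a"
    using lanczos_residual_normalized[OF A w, of j] lanczos_q_carrier[OF A w, of "Suc (Suc j)"] a
    by (metis carrier_vecD index_smult_vec(1))
  also have "\<dots> = (A *\<^sub>v lanczos_q n A w (Suc j)) $ a
      - lanczos_\<alpha> n A w (Suc j) * lanczos_q n A w (Suc j) $ a - lanczos_\<beta> n A w j * lanczos_q n A w j $ a"
    using lanczos_q_carrier[OF A w, of "Suc j"] lanczos_q_carrier[OF A w, of j] a A
    by (simp add: lanczos_residual_def del: index_mult_mat_vec)
  finally show ?thesis by simp
qed

lemma lanczos_three_term_scalar_prod: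
  assumes A: "A \<in> carrier_mat n n" and w: "w \<in> carrier_vec n" and y: "y \<in> carrier_vec n"
  shows "y \<bullet> (A *\<^sub>v lanczos_q n A w (Suc j)) =
    lanczos_\<beta> n A w (Suc j) * (y \<bullet> lanczos_q n A w (Suc (Suc j)))
      + lanczos_\<alpha> n A w (Suc j) * (y \<bullet> lanczos_q n A w (Suc j))
      + lanczos_\<beta> n A w j * (y \<bullet> lanczos_q n A w j)"
proof -
  have "y \<bullet> (A *\<^sub>v lanczos_q n A w (Suc j)) = (\<Sum>a = 0..<n. y $ a * (A *\<^sub>v lanczos_q n A w (Suc j)) $ a)"
    using A by (simp add: scalar_prod_def del: index_mult_mat_vec)
  also have "\<dots> = (\<Sum>a = 0..<n. lanczos_\<beta> n A w (Suc j) * (y $ a * lanczos_q n A w (Suc (Suc j)) $ a)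
      + lanczos_\<alpha> n A w (Suc j) * (y $ a * lanczos_q n A w (Suc j) $ a)
      + lanczos_\<beta> n A w j * (y $ a * lanczos_q n A w j $ a))"
    by (rule sum.cong[OF refl])
      (simp add: lanczos_three_term[OF A w] distrib_left mult.left_commute del: index_mult_mat_vec)
  also have "\<dots> = lanczos_\<beta> n A w (Suc j) * (y \<bullet> lanczos_q n A w (Suc (Suc j)))
      + lanczos_\<alpha> n A w (Suc j) * (y \<bullet> lanczos_q n A w (Suc j))
      + lanczos_\<beta> n A w j * (y \<bullet> lanczos_q n A w j)"
    using carrier_vecD[OF lanczos_q_carrier[OF A w]]
    by (simp add: scalar_prod_def sum.distrib sum_distrib_left)
  finally show ?thesis .
qed

lemma symmetric_scalar_prod:
  fixes A :: "real mat"
  assumes A: "A \<in> carrier_mat n n" and sym: "transpose_mat A = A"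
    and x: "x \<in> carrier_vec n" and y: "y \<in> carrier_vec n"
  shows "x \<bullet> (A *\<^sub>v y) = y \<bullet> (A *\<^sub>v x)"
proof -
  have "x \<bullet> (A *\<^sub>v y) = (A *\<^sub>v x) \<bullet> y"
    using transpose_vec_mult_scalar[OF A y x] unfolding sym by simp
  also have "\<dots> = y \<bullet> (A *\<^sub>v x)"
    by (rule comm_scalar_prod[OF _ y]) (use A in simp)
  finally show ?thesis .
qed

text \<open>Induction on \<open>m\<close>. Pairing the recurrence for the new vector with an old \<open>q\<^sub>i\<close> leaves
\<open>q\<^sub>i \<bullet> A q\<^sub>m - \<alpha>\<^sub>m (q\<^sub>i \<bullet> q\<^sub>m) - \<beta>\<^sub>m\<^sub>-\<^sub>1 (q\<^sub>i \<bullet> q\<^sub>m\<^sub>-\<^sub>1)\<close>. For \<open>i = m\<close> this vanishes by the choice of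
\<open>\<alpha>\<^sub>m\<close>. For \<open>i < m\<close> symmetry turns \<open>q\<^sub>i \<bullet> A q\<^sub>m\<close> into \<open>q\<^sub>m \<bullet> A q\<^sub>i\<close>, and the recurrence for \<open>q\<^sub>i\<close> makes it
\<open>\<beta>\<^sub>m\<^sub>-\<^sub>1\<close> if \<open>i = m - 1\<close> and 0 otherwise, which is exactly the last term. The starting value
\<open>q\<^sub>0 = 0\<close> is included, whence the condition \<open>0 < i\<close>.\<close>

lemma lanczos_orthonormal:
  assumes A: "A \<in> carrier_mat n n" and sym: "transpose_mat A = A"
    and w: "w \<in> carrier_vec n" and w0: "w \<noteq> 0\<^sub>v n"
    and nobreak: "\<And>j. 0 < j \<Longrightarrow> j < m \<Longrightarrow> lanczos_\<beta> n A w j \<noteq> 0"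
    and i: "i \<le> m" and j: "j \<le> m"
  shows "lanczos_q n A w i \<bullet> lanczos_q n A w j = (if i = j \<and> 0 < i then 1 else 0)"
  using nobreak i j
proof (induction m arbitrary: i j)
  case 0
  then show ?case by (simp add: lanczos_q_0)
next
  case (Suc m)
  let ?q = "lanczos_q n A w" and ?\<alpha> = "lanczos_\<alpha> n A w" and ?\<beta> = "lanczos_\<beta> n A w"
  have qc: "?q i \<in> carrier_vec n" for i by (rule lanczos_q_carrier[OF A w])
  have IH: "?q i \<bullet> ?q j = (if i = j \<and> 0 < i then 1 else 0)" if "i \<le> m" "j \<le> m" for i j
    using Suc.IH[of i j] Suc.prems(1) that by simp
  have new_norm: "?q (Suc m) \<bullet> ?q (Suc m) = 1"
  proof (cases m)
    case 0
    have "norm2_vec w \<noteq> 0"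
      using norm2_vec_eq_0_iff[OF w] w0 by simp
    then have "norm2_vec (?q (Suc m)) = 1"
      unfolding 0 lanczos_q_1 norm2_vec_smult using norm2_vec_nonneg by simp
    then show ?thesis by (simp flip: norm2_vec_sq)
  next
    case (Suc p)
    then have "norm2_vec (lanczos_residual n A w p) \<noteq> 0"
      using Suc.prems(1)[of m] by (simp add: lanczos_\<beta>_Suc)
    then have "norm2_vec (?q (Suc m)) = 1"
      unfolding Suc lanczos_q_Suc_Suc lanczos_\<beta>_Suc norm2_vec_smult using norm2_vec_nonneg by simp
    then show ?thesis by (simp flip: norm2_vec_sq)
  qed
  have new_orth: "?q i \<bullet> ?q (Suc m) = 0" if le: "i \<le> m" for i
  proof (cases i)
    case 0
    then show ?thesis using qc by (simp add: lanczos_q_0)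
  next
    case (Suc i')
    then obtain p where m: "m = Suc p" using le by (cases m) auto
    have "?\<beta> m * (?q i \<bullet> ?q (Suc m)) = ?q i \<bullet> (A *\<^sub>v ?q m) - ?\<alpha> m * (?q i \<bullet> ?q m) - ?\<beta> p * (?q i \<bullet> ?q p)"
      using lanczos_three_term_scalar_prod[OF A w qc, of i p] unfolding m by simp
    also have "\<dots> = 0"
    proof (cases "i = m")
      case True
      then show ?thesis using IH[of m m] IH[of m p] m by (simp add: lanczos_\<alpha>_def)
    next
      case False
      have "?q i \<bullet> (A *\<^sub>v ?q m) = ?q m \<bullet> (A *\<^sub>v ?q i)"
        by (rule symmetric_scalar_prod[OF A sym qc qc])
      also have "\<dots> = ?\<beta> i * (?q m \<bullet> ?q (Suc i)) + ?\<alpha> i * (?q m \<bullet> ?q i) + ?\<beta> i' * (?q m \<bullet> ?q i')"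
        using lanczos_three_term_scalar_prod[OF A w qc, of m i'] unfolding Suc by simp
      finally show ?thesis
        using False le IH[of m "Suc i"] IH[of m i] IH[of m i'] IH[of i m] IH[of i p] Suc m by auto
    qed
    finally show ?thesis using Suc.prems(1)[of m] m by simp
  qed
  consider "i \<le> m" "j \<le> m" | "i \<le> m" "j = Suc m" | "i = Suc m" "j \<le> m" | "i = Suc m" "j = Suc m"
    using Suc.prems(2,3) by linarith
  then show ?case
  proof cases
    case 3
    then show ?thesis using new_orth[of j] comm_scalar_prod[OF qc qc, of "Suc m" j] by simp
  qed (use IH new_norm new_orth in auto)
qed

lemma lanczos_Q_carrier: "lanczos_Q n A w k \<in> carrier_mat n k"
  unfolding lanczos_Q_def by (rule carrier_matI) simp_all

lemma col_lanczos_Q: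
  assumes A: "A \<in> carrier_mat n n" and w: "w \<in> carrier_vec n" and j: "j < k"
  shows "col (lanczos_Q n A w k) j = lanczos_q n A w (Suc j)"
  unfolding lanczos_Q_def
  by (subst col_mat_of_cols) (use j lanczos_q_carrier[OF A w] in \<open>auto simp del: upt_Suc\<close>)

lemma lanczos_Q_orthonormal:
  assumes A: "A \<in> carrier_mat n n" and sym: "transpose_mat A = A"
    and w: "w \<in> carrier_vec n" and w0: "w \<noteq> 0\<^sub>v n"
    and nobreak: "\<And>j. 0 < j \<Longrightarrow> j < k \<Longrightarrow> lanczos_\<beta> n A w j \<noteq> 0"
  shows "transpose_mat (lanczos_Q n A w k) * lanczos_Q n A w k = 1\<^sub>m k"
proof (rule eq_matI)
  have Q: "dim_col (lanczos_Q n A w k) = k" using lanczos_Q_carrier by blast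
  fix i j assume "i < dim_row (1\<^sub>m k :: real mat)" and "j < dim_col (1\<^sub>m k :: real mat)"
  then show "(transpose_mat (lanczos_Q n A w k) * lanczos_Q n A w k) $$ (i, j) = 1\<^sub>m k $$ (i, j)"
    using Q lanczos_orthonormal[OF A sym w w0 nobreak, where i = "Suc i" and j = "Suc j"]
    by (simp add: col_lanczos_Q[OF A w])
qed (use lanczos_Q_carrier[of n A w k] in auto)

lemma mult_lanczos_Q:
  assumes A: "A \<in> carrier_mat n n" and w: "w \<in> carrier_vec n"
  shows "lanczos_Q n A w (k + 1) * lanczos_T n A w k = A * lanczos_Q n A w k"
proof (rule eq_matI)
  let ?q = "lanczos_q n A w" and ?\<alpha> = "lanczos_\<alpha> n A w" and ?\<beta> = "lanczos_\<beta> n A w"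
  let ?Q = "lanczos_Q n A w (k + 1)" and ?T = "lanczos_T n A w k"
  have Qk: "lanczos_Q n A w k \<in> carrier_mat n k" and Q: "?Q \<in> carrier_mat n (k + 1)"
    by (rule lanczos_Q_carrier)+
  have T: "?T \<in> carrier_mat (k + 1) k" by (simp add: lanczos_T_def)
  fix a j assume "a < dim_row (A * lanczos_Q n A w k)" and "j < dim_col (A * lanczos_Q n A w k)"
  then have a: "a < n" and j: "j < k" using A Qk by auto
  have Qa: "?Q $$ (a, i) = ?q (Suc i) $ a" if "i < k + 1" for i
    using that a Q col_lanczos_Q[OF A w that] by (metis carrier_matD index_col)
  have "(?Q * ?T) $$ (a, j) = (\<Sum>i = 0..<k + 1. ?Q $$ (a, i) * ?T $$ (i, j))"
    using a j Q T by (simp add: scalar_prod_def del: sum.op_ivl_Suc)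
  also have "\<dots> = (\<Sum>i = 0..<k + 1. ?q (Suc i) $ a * ?T $$ (i, j))"
    by (rule sum.cong[OF refl]) (use Qa in simp)
  \<comment> \<open>Column \<open>j\<close> of the tridiagonal matrix has at most three nonzero entries.\<close>
  also have "\<dots> = (\<Sum>i = 0..<k + 1. (if i = j then ?\<alpha> (Suc j) * ?q (Suc j) $ a else 0)
      + (if i = Suc j then ?\<beta> (Suc j) * ?q (Suc (Suc j)) $ a else 0)
      + (if Suc i = j then ?\<beta> j * ?q j $ a else 0))"
    by (rule sum.cong[OF refl]) (use j in \<open>auto simp: lanczos_T_def\<close>)
  also have "\<dots> = ?\<alpha> (Suc j) * ?q (Suc j) $ a + ?\<beta> (Suc j) * ?q (Suc (Suc j)) $ a + ?\<beta> j * ?q j $ a"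
  proof -
    have "(\<Sum>i = 0..<k + 1. if Suc i = j then ?\<beta> j * ?q j $ a else 0) = ?\<beta> j * ?q j $ a"
      using j by (cases j) (simp_all add: lanczos_\<beta>_0 del: sum.op_ivl_Suc)
    then show ?thesis
      using j by (simp add: sum.distrib del: sum.op_ivl_Suc)
  qed
  also have "\<dots> = (A *\<^sub>v ?q (Suc j)) $ a"
    by (simp add: lanczos_three_term[OF A w a] del: index_mult_mat_vec)
  also have "\<dots> = (A * lanczos_Q n A w k) $$ (a, j)"
    using a j A Qk by (simp add: col_lanczos_Q[OF A w])
  finally show "(?Q * ?T) $$ (a, j) = (A * lanczos_Q n A w k) $$ (a, j)" .
qed (use A lanczos_Q_carrier[of n A w k] lanczos_Q_carrier[of n A w "k + 1"] in \<open>auto simp: lanczos_T_def\<close>)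

text \<open>A polynomial in \<open>A\<close> applied to \<open>w\<close> reads in spectral coordinates as its values at \<open>d\<close> times the
coordinates of \<open>w\<close>. In the recurrence for the residual, the factor \<open>X - \<alpha>\<close> raises the degree by one and
\<open>\<beta> p'\<close> has too small a degree to cancel the leading coefficient.\<close>

lemma lanczos_residual_polynomial:
  assumes V: "V \<in> carrier_mat n n" and orth: "transpose_mat V * V = 1\<^sub>m n"
    and spectral: "A = V * mat_diag n d * transpose_mat V" and w: "w \<in> carrier_vec n"
    and p: "p \<noteq> 0" "degree p = m" "degree p' \<le> m"
    and q: "\<And>i. i < n \<Longrightarrow> (transpose_mat V *\<^sub>v lanczos_q n A w (Suc m)) $ i = poly p (d i) * (transpose_mat V *\<^sub>v w) $ i"
    and q': "\<And>i. i < n \<Longrightarrow> (transpose_mat V *\<^sub>v lanczos_q n A w m) $ i = poly p' (d i) * (transpose_mat V *\<^sub>v w) $ i"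
  shows "\<exists>R. degree R = Suc m \<and>
    (\<forall>i<n. (transpose_mat V *\<^sub>v lanczos_residual n A w m) $ i = poly R (d i) * (transpose_mat V *\<^sub>v w) $ i)"
proof (intro exI conjI allI impI)
  let ?\<alpha> = "lanczos_\<alpha> n A w (Suc m)" and ?\<beta> = "lanczos_\<beta> n A w m"
  let ?q = "lanczos_q n A w (Suc m)" and ?q' = "lanczos_q n A w m"
  let ?R = "[:- ?\<alpha>, 1:] * p - Polynomial.smult ?\<beta> p'"
  have "degree ([:- ?\<alpha>, 1:] * p) = Suc m"
    using p by (subst degree_mult_eq) auto
  moreover have "degree (- Polynomial.smult ?\<beta> p') < Suc m"
    using degree_smult_le[of ?\<beta> p'] p(3) by simp
  ultimately have "degree ([:- ?\<alpha>, 1:] * p + (- Polynomial.smult ?\<beta> p')) = Suc m"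
    by (subst degree_add_eq_left) auto
  then show "degree ?R = Suc m" by simp
  fix i assume i: "i < n"
  have A: "A \<in> carrier_mat n n"
    unfolding spectral using V by (intro carrier_matI) auto
  note qc = lanczos_q_carrier[OF A w]
  have coord: "(transpose_mat V *\<^sub>v x) $ i = col V i \<bullet> x" for x
    using V i by simp
  have v: "col V i \<in> carrier_vec n" using V by auto
  have Aq: "A *\<^sub>v ?q \<in> carrier_vec n" using A by simp
  have "(transpose_mat V *\<^sub>v lanczos_residual n A w m) $ i
    = col V i \<bullet> (A *\<^sub>v ?q) - ?\<alpha> * (col V i \<bullet> ?q) - ?\<beta> * (col V i \<bullet> ?q')"
    unfolding coord lanczos_residual_def
    using v Aq qc[of "Suc m"] qc[of m]
    by (simp add: scalar_prod_minus_distrib[of _ n])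
  also have "\<dots> = poly ?R (d i) * (transpose_mat V *\<^sub>v w) $ i"
    using spectral_coordinate[OF V orth spectral qc i, of "Suc m"] q[OF i] q'[OF i]
    unfolding coord by (simp add: algebra_simps)
  finally show "(transpose_mat V *\<^sub>v lanczos_residual n A w m) $ i = poly ?R (d i) * (transpose_mat V *\<^sub>v w) $ i" .
qed

lemma lanczos_q_polynomial:
  assumes V: "V \<in> carrier_mat n n" and orth: "transpose_mat V * V = 1\<^sub>m n"
    and spectral: "A = V * mat_diag n d * transpose_mat V"
    and w: "w \<in> carrier_vec n" and w0: "w \<noteq> 0\<^sub>v n"
    and nobreak: "\<And>j. 0 < j \<Longrightarrow> j \<le> m \<Longrightarrow> lanczos_\<beta> n A w j \<noteq> 0"
  shows "\<exists>p p'. p \<noteq> 0 \<and> degree p = m \<and> degree p' \<le> m \<and>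
    (\<forall>i<n. (transpose_mat V *\<^sub>v lanczos_q n A w (Suc m)) $ i = poly p (d i) * (transpose_mat V *\<^sub>v w) $ i) \<and>
    (\<forall>i<n. (transpose_mat V *\<^sub>v lanczos_q n A w m) $ i = poly p' (d i) * (transpose_mat V *\<^sub>v w) $ i)"
  using nobreak
proof (induction m)
  case 0
  have "norm2_vec w \<noteq> 0" using norm2_vec_eq_0_iff[OF w] w0 by simp
  moreover have "(transpose_mat V *\<^sub>v lanczos_q n A w (Suc 0)) $ i = 1 / norm2_vec w * (transpose_mat V *\<^sub>v w) $ i"
    if "i < n" for i
    using that V w by (simp add: lanczos_q_1)
  moreover have "(transpose_mat V *\<^sub>v lanczos_q n A w 0) $ i = 0" if "i < n" for i
    using that V by (simp add: lanczos_q_0 scalar_prod_right_zero[of _ n])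
  ultimately show ?case
    by (intro exI[of _ "[:1 / norm2_vec w:]"] exI[of _ 0])
      (simp del: index_mult_mat_vec)
next
  case (Suc m)
  have "\<exists>p p'. p \<noteq> 0 \<and> degree p = m \<and> degree p' \<le> m \<and>
    (\<forall>i<n. (transpose_mat V *\<^sub>v lanczos_q n A w (Suc m)) $ i = poly p (d i) * (transpose_mat V *\<^sub>v w) $ i) \<and>
    (\<forall>i<n. (transpose_mat V *\<^sub>v lanczos_q n A w m) $ i = poly p' (d i) * (transpose_mat V *\<^sub>v w) $ i)"
    by (rule Suc.IH) (use Suc.prems in simp)
  then obtain p p' where p: "p \<noteq> 0" "degree p = m" "degree p' \<le> m"
    and q: "\<And>i. i < n \<Longrightarrow> (transpose_mat V *\<^sub>v lanczos_q n A w (Suc m)) $ i = poly p (d i) * (transpose_mat V *\<^sub>v w) $ i"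
    and q': "\<And>i. i < n \<Longrightarrow> (transpose_mat V *\<^sub>v lanczos_q n A w m) $ i = poly p' (d i) * (transpose_mat V *\<^sub>v w) $ i"
    by blast
  obtain R where R: "degree R = Suc m"
    "\<And>i. i < n \<Longrightarrow> (transpose_mat V *\<^sub>v lanczos_residual n A w m) $ i = poly R (d i) * (transpose_mat V *\<^sub>v w) $ i"
    using lanczos_residual_polynomial[OF V orth spectral w p q q'] by blast
  let ?\<beta> = "lanczos_\<beta> n A w (Suc m)"
  have \<beta>: "?\<beta> \<noteq> 0" using Suc.prems by simp
  have A: "A \<in> carrier_mat n n"
    unfolding spectral using V by (intro carrier_matI) auto
  have "(transpose_mat V *\<^sub>v lanczos_q n A w (Suc (Suc m))) $ i
      = 1 / ?\<beta> * (transpose_mat V *\<^sub>v lanczos_residual n A w m) $ i" if "i < n" for i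
    unfolding lanczos_q_Suc_Suc using that V lanczos_residual_carrier[OF A w, of m] by simp
  then have "(transpose_mat V *\<^sub>v lanczos_q n A w (Suc (Suc m))) $ i
      = poly (Polynomial.smult (1 / ?\<beta>) R) (d i) * (transpose_mat V *\<^sub>v w) $ i" if "i < n" for i
    using that R(2)[OF that] by (simp del: index_mult_mat_vec)
  moreover have "Polynomial.smult (1 / ?\<beta>) R \<noteq> 0" "degree (Polynomial.smult (1 / ?\<beta>) R) = Suc m"
    using \<beta> R(1) by auto
  ultimately show ?case
    using q p by (intro exI[of _ "Polynomial.smult (1 / ?\<beta>) R"] exI[of _ p]) (simp del: index_mult_mat_vec)
qed

text \<open>A breakdown at step \<open>j < n\<close> would give a nonzero polynomial of degree \<open>j\<close> that annihilates \<open>w\<close>. As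
every spectral coordinate of \<open>w\<close> is nonzero, it would vanish at all \<open>n\<close> distinct eigenvalues.\<close>

lemma lanczos_no_breakdown:
  assumes V: "V \<in> carrier_mat n n" and orth: "transpose_mat V * V = 1\<^sub>m n"
    and spectral: "A = V * mat_diag n d * transpose_mat V" and inj: "inj_on d {..<n}"
    and w: "w \<in> carrier_vec n" and coords: "\<And>i. i < n \<Longrightarrow> (transpose_mat V *\<^sub>v w) $ i \<noteq> 0"
    and j: "0 < j" "j < n"
  shows "lanczos_\<beta> n A w j \<noteq> 0"
  using j
proof (induction j rule: less_induct)
  case (less j)
  then obtain m where m: "j = Suc m" by (cases j) auto
  have w0: "w \<noteq> 0\<^sub>v n"
  proof
    assume "w = 0\<^sub>v n"
    moreover have "col V 0 \<bullet> 0\<^sub>v n = 0"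
      by (rule scalar_prod_right_zero) (use V in auto)
    ultimately show False using coords[of 0] less.prems V by simp
  qed
  have "lanczos_\<beta> n A w i \<noteq> 0" if "0 < i" "i \<le> m" for i
    using less.IH[of i] less.prems m that by simp
  from lanczos_q_polynomial[OF V orth spectral w w0 this]
  obtain p p' where p: "p \<noteq> 0" "degree p = m" "degree p' \<le> m"
    and q: "\<And>i. i < n \<Longrightarrow> (transpose_mat V *\<^sub>v lanczos_q n A w (Suc m)) $ i = poly p (d i) * (transpose_mat V *\<^sub>v w) $ i"
    and q': "\<And>i. i < n \<Longrightarrow> (transpose_mat V *\<^sub>v lanczos_q n A w m) $ i = poly p' (d i) * (transpose_mat V *\<^sub>v w) $ i"
    by blast
  obtain R where R: "degree R = Suc m"
    "\<And>i. i < n \<Longrightarrow> (transpose_mat V *\<^sub>v lanczos_residual n A w m) $ i = poly R (d i) * (transpose_mat V *\<^sub>v w) $ i"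
    using lanczos_residual_polynomial[OF V orth spectral w p q q'] by blast
  have A: "A \<in> carrier_mat n n"
    unfolding spectral using V by (intro carrier_matI) auto
  show ?case
  proof
    assume "lanczos_\<beta> n A w j = 0"
    then have "lanczos_residual n A w m = 0\<^sub>v n"
      using norm2_vec_eq_0_iff[OF lanczos_residual_carrier[OF A w]] by (simp add: m lanczos_\<beta>_Suc)
    then have "(transpose_mat V *\<^sub>v lanczos_residual n A w m) $ i = 0" if "i < n" for i
      using that V by (simp add: scalar_prod_right_zero[of _ n])
    then have "poly R (d i) = 0" if "i < n" for i
      using R(2)[OF that] coords[OF that] that by simp
    then have "d ` {..<n} \<subseteq> {x. poly R x = 0}" by auto
    moreover have "R \<noteq> 0" using R(1) by auto
    ultimately have "card (d ` {..<n}) \<le> degree R"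
      using card_mono[OF poly_roots_finite] card_poly_roots_bound order.trans by blast
    then show False using card_image[OF inj] R(1) m less.prems by simp
  qed
qed

text \<open>Both inclusions go by induction and read the three-term recurrence in the two possible directions:
\<open>A q\<^sub>j\<close> is a combination of \<open>q\<^sub>j\<^sub>+\<^sub>1\<close>, \<open>q\<^sub>j\<close>, \<open>q\<^sub>j\<^sub>-\<^sub>1\<close>, and \<open>q\<^sub>j\<^sub>+\<^sub>1\<close> is a multiple of a combination of
\<open>A q\<^sub>j\<close>, \<open>q\<^sub>j\<close>, \<open>q\<^sub>j\<^sub>-\<^sub>1\<close>. A breakdown does no harm, as it sets \<open>q\<^sub>j\<^sub>+\<^sub>1 = 0\<close>.\<close>

lemma krylov_eq_span_lanczos:
  assumes A: "A \<in> carrier_mat n n" and w: "w \<in> carrier_vec n" and w0: "w \<noteq> 0\<^sub>v n"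
  shows "krylov n A w k = span_vec n (set (cols (lanczos_Q n A w k)))"
proof
  let ?q = "lanczos_q n A w"
  \<comment> \<open>Spans of the first \<open>m\<close> Lanczos vectors and of the first \<open>m\<close> Krylov vectors.\<close>
  define S where "S m = (\<lambda>j. ?q (Suc j)) ` {..<m}" for m
  define G where "G m = (\<lambda>i. (A ^\<^sub>m i) *\<^sub>v w) ` {..<m}" for m
  note qc = lanczos_q_carrier[OF A w]
  have pow: "A ^\<^sub>m j \<in> carrier_mat n n" for j using A by simp
  have Sc: "S m \<subseteq> carrier_vec n" for m using qc by (auto simp: S_def)
  have Gc: "G m \<subseteq> carrier_vec n" for m
    unfolding G_def using mult_mat_vec_carrier_row[OF pow] by blast
  have S_span: "?q (Suc j) \<in> span_vec n (S m)" if "j < m" for j m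
    by (rule span_vec_superset[OF Sc]) (use that in \<open>auto simp: S_def\<close>)
  have G_span: "(A ^\<^sub>m i) *\<^sub>v w \<in> span_vec n (G m)" if "i < m" for i m
    by (rule span_vec_superset[OF Gc]) (use that in \<open>auto simp: G_def\<close>)
  have cols: "set (cols (lanczos_Q n A w k)) = S k"
  proof -
    have "set (cols (lanczos_Q n A w k)) = col (lanczos_Q n A w k) ` {..<k}"
      using lanczos_Q_carrier[of n A w k] by (auto simp: cols_def)
    also have "\<dots> = S k"
      unfolding S_def by (rule image_cong[OF refl]) (simp add: col_lanczos_Q[OF A w])
    finally show ?thesis .
  qed
  have "(A ^\<^sub>m i) *\<^sub>v w \<in> span_vec n (S (Suc i))" for i
  proof (induction i)
    case 0
    have "norm2_vec w \<noteq> 0" using norm2_vec_eq_0_iff[OF w] w0 by simp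
    then have "(A ^\<^sub>m 0) *\<^sub>v w = norm2_vec w \<cdot>\<^sub>v ?q (Suc 0)"
      using A w by (simp add: lanczos_q_1 smult_smult_assoc)
    then show ?case using span_vec_smult[OF Sc S_span] by simp
  next
    case (Suc i)
    have "A *\<^sub>v s \<in> span_vec n (S (Suc (Suc i)))" if s_in: "s \<in> S (Suc i)" for s
    proof -
      obtain j where j: "j < Suc i" and s: "s = ?q (Suc j)" using s_in by (auto simp: S_def)
      have "A *\<^sub>v s = 1 \<cdot>\<^sub>v (lanczos_\<beta> n A w (Suc j) \<cdot>\<^sub>v ?q (Suc (Suc j))
          + lanczos_\<alpha> n A w (Suc j) \<cdot>\<^sub>v ?q (Suc j)) + lanczos_\<beta> n A w j \<cdot>\<^sub>v ?q j"
        unfolding s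
        by (rule eq_vecI)
          (use A carrier_vecD[OF qc] in \<open>simp_all add: lanczos_three_term[OF A w] del: index_mult_mat_vec\<close>)
      moreover have "?q j \<in> span_vec n (S (Suc (Suc i)))"
        using j S_span by (cases j) (simp_all add: lanczos_q_0 span_vec_zero)
      ultimately show ?thesis
        using j by (simp only:) (intro span_vec_lin[OF Sc] S_span, simp_all)
    qed
    from mult_mat_vec_span[OF A Sc Sc this Suc.IH]
    show ?case unfolding pow_mat_mult_vec_Suc[OF A w] .
  qed
  moreover have "span_vec n (S (Suc i)) \<subseteq> span_vec n (S k)" if "i < k" for i
    by (rule span_vec_mono) (use that in \<open>auto simp: S_def\<close>)
  ultimately have "G k \<subseteq> span_vec n (S k)"
    unfolding G_def by blast
  then show "krylov n A w k \<subseteq> span_vec n (set (cols (lanczos_Q n A w k)))"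
    unfolding cols krylov_def G_def[symmetric] by (rule span_vec_minimal[OF _ Sc])
  have "?q j \<in> span_vec n (G j) \<and> ?q (Suc j) \<in> span_vec n (G (Suc j))" for j
  proof (induction j)
    case 0
    have "(A ^\<^sub>m 0) *\<^sub>v w = w" using A w by simp
    then show ?case
      using span_vec_smult[OF Gc G_span[of 0 "Suc 0"]] by (simp add: lanczos_q_0 lanczos_q_1 span_vec_zero)
  next
    case (Suc j)
    have mono: "span_vec n (G l) \<subseteq> span_vec n (G (Suc (Suc j)))" if "l \<le> Suc (Suc j)" for l
      by (rule span_vec_mono) (use that in \<open>auto simp: G_def\<close>)
    have "A *\<^sub>v s \<in> span_vec n (G (Suc (Suc j)))" if s_in: "s \<in> G (Suc j)" for s
    proof -
      obtain i where i: "i < Suc j" and s: "s = (A ^\<^sub>m i) *\<^sub>v w" using s_in by (auto simp: G_def)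
      show ?thesis
        unfolding s pow_mat_mult_vec_Suc[OF A w, symmetric] by (rule G_span) (use i in simp)
    qed
    from mult_mat_vec_span[OF A Gc Gc this] Suc
    have Aq: "A *\<^sub>v ?q (Suc j) \<in> span_vec n (G (Suc (Suc j)))" by blast
    have "lanczos_residual n A w j = 1 \<cdot>\<^sub>v (1 \<cdot>\<^sub>v (A *\<^sub>v ?q (Suc j)) + (- lanczos_\<alpha> n A w (Suc j)) \<cdot>\<^sub>v ?q (Suc j))
        + (- lanczos_\<beta> n A w j) \<cdot>\<^sub>v ?q j"
      by (rule eq_vecI)
        (use A carrier_vecD[OF qc] in \<open>simp_all add: lanczos_residual_def del: index_mult_mat_vec\<close>)
    then have "lanczos_residual n A w j \<in> span_vec n (G (Suc (Suc j)))"
      using Suc mono[of j] mono[of "Suc j"] by (simp only:) (intro span_vec_lin[OF Gc] Aq, auto)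
    then show ?case
      unfolding lanczos_q_Suc_Suc using Suc span_vec_smult[OF Gc] by blast
  qed
  moreover have "span_vec n (G (Suc i)) \<subseteq> span_vec n (G k)" if "i < k" for i
    by (rule span_vec_mono) (use that in \<open>auto simp: G_def\<close>)
  ultimately have "S k \<subseteq> span_vec n (G k)"
    unfolding S_def by blast
  then show "span_vec n (set (cols (lanczos_Q n A w k))) \<subseteq> krylov n A w k"
    unfolding cols krylov_def G_def[symmetric] by (rule span_vec_minimal[OF _ Gc])
qed

section \<open>The Lanczos approximation error\<close>

lemma deflation_mult_vec:
  fixes A :: "real mat"
  assumes A: "A \<in> carrier_mat n n" and Q: "Q \<in> carrier_mat n k" and x: "x \<in> carrier_vec n"
  shows "(A - A * Q * transpose_mat Q) *\<^sub>v x = A *\<^sub>v (x - Q *\<^sub>v (transpose_mat Q *\<^sub>v x))"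
proof -
  have Qt: "transpose_mat Q \<in> carrier_mat k n" and c: "transpose_mat Q *\<^sub>v x \<in> carrier_vec k"
    and Qc: "Q *\<^sub>v (transpose_mat Q *\<^sub>v x) \<in> carrier_vec n" and AQ: "A * Q \<in> carrier_mat n k"
    using A Q by auto
  have "(A - A * Q * transpose_mat Q) *\<^sub>v x = A *\<^sub>v x - (A * Q * transpose_mat Q) *\<^sub>v x"
    by (rule minus_mult_distrib_mat_vec[OF A mult_carrier_mat[OF AQ Qt] x])
  also have "(A * Q * transpose_mat Q) *\<^sub>v x = A *\<^sub>v (Q *\<^sub>v (transpose_mat Q *\<^sub>v x))"
    using assoc_mult_mat_vec[OF AQ Qt x] assoc_mult_mat_vec[OF A Q c] by simp
  also have "A *\<^sub>v x - \<dots> = A *\<^sub>v (x - Q *\<^sub>v (transpose_mat Q *\<^sub>v x))"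
    by (rule mult_minus_distrib_mat_vec[OF A x Qc, symmetric])
  finally show ?thesis .
qed

text \<open>Apply the spectral estimate to \<open>y = x - Q Q\<^sup>T x\<close>, where \<open>|y| \<le> |x|\<close>. It remains to bound
\<open>|V\<^sub>k\<^sup>T y|\<close> by \<open>s |x|\<close> with \<open>s\<close> the sine of the largest angle. The sine is defined by the residuals of
vectors of \<open>range Q\<close> against \<open>range V\<^sub>k\<close>; the estimate needs them the other way round, which is where
the symmetry of the gap enters.\<close>

lemma norm2_mat_deflation_le:
  fixes V :: "real mat"
  assumes V: "V \<in> carrier_mat n n" and orth: "transpose_mat V * V = 1\<^sub>m n"
    and A: "A = V * mat_diag n d * transpose_mat V"
    and Q: "Q \<in> carrier_mat n k" "transpose_mat Q * Q = 1\<^sub>m k" and k: "k \<le> n"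
    and head: "\<And>i. i < k \<Longrightarrow> \<bar>d i\<bar> \<le> a" and tail: "\<And>i. k \<le> i \<Longrightarrow> i < n \<Longrightarrow> \<bar>d i\<bar> \<le> c"
    and ac: "0 \<le> a" "0 \<le> c"
  shows "norm2_mat (A - A * Q * transpose_mat Q) \<le> c + a *
    norm_sin_Theta n (span_vec n (set (cols (col_range V 0 k)))) (span_vec n (set (cols Q)))"
proof -
  let ?H = "col_range V 0 k"
  let ?s = "norm_sin_Theta n (span_vec n (set (cols ?H))) (span_vec n (set (cols Q)))"
  have H: "?H \<in> carrier_mat n k" "transpose_mat ?H * ?H = 1\<^sub>m k"
    using col_range_carrier[OF V, of 0 k] frame_col_range[OF V orth k, of 0] by simp_all
  have A': "A \<in> carrier_mat n n"
    unfolding A using V by (intro carrier_matI) auto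
  note gap = norm_sin_Theta_gap[OF H Q orthonormal_basis_mat_complement[OF V orth k]]
  show ?thesis
  proof (rule norm2_mat_leI)
    show "A - A * Q * transpose_mat Q \<in> carrier_mat n n"
      using A' Q(1) by (intro carrier_matI) auto
    show "0 \<le> c + a * ?s" using ac gap(1) by simp
    fix x :: "real vec" assume x: "x \<in> carrier_vec n"
    let ?y = "x - Q *\<^sub>v (transpose_mat Q *\<^sub>v x)"
    have y: "?y \<in> carrier_vec n" using Q(1) x by simp
    have "norm2_vec (?H *\<^sub>v z - Q *\<^sub>v (transpose_mat Q *\<^sub>v (?H *\<^sub>v z))) \<le> ?s * norm2_vec z"
      if "z \<in> carrier_vec k" for z
      by (rule frame_gap_symmetric[OF H Q gap that])
    from norm2_transpose_residual_le[OF H(1) Q(1) this gap(1) x]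
    have "norm2_vec (transpose_mat ?H *\<^sub>v ?y) \<le> ?s * norm2_vec x" .
    moreover have "norm2_vec ?y \<le> norm2_vec x"
      by (rule norm2_frame_residual_le[OF Q x])
    ultimately have "c * norm2_vec ?y + a * norm2_vec (transpose_mat ?H *\<^sub>v ?y)
        \<le> c * norm2_vec x + a * (?s * norm2_vec x)"
      using ac by (intro add_mono mult_left_mono)
    then have "norm2_vec (A *\<^sub>v ?y) \<le> (c + a * ?s) * norm2_vec x"
      using norm2_spectral_le[OF V orth A y k head tail ac] by (simp add: distrib_right)
    then show "norm2_vec ((A - A * Q * transpose_mat Q) *\<^sub>v x) \<le> (c + a * ?s) * norm2_vec x"
      unfolding deflation_mult_vec[OF A' Q(1) x] .
  qed
qed

theorem theorem5p2:
  fixes n k :: nat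
    and A V :: "real mat"
    and b :: "real vec"
    and lam \<sigma> :: "nat \<Rightarrow> real"
    and \<gamma> :: "nat \<Rightarrow> real"
  assumes A: "A \<in> carrier_mat n n"
    and A_sym: "transpose_mat A = A"
    and V: "V \<in> carrier_mat n n"
    and V_orth: "transpose_mat V * V = 1\<^sub>m n"
    and spectral: "A = V * mat_diag n (\<lambda>i. lam (i + 1)) * transpose_mat V"
    and sigma: "\<And>j. j \<in> {1..n} \<Longrightarrow> \<sigma> j = \<bar>lam j\<bar>"
    and sigma_decreasing: "\<And>j. j \<in> {1..<n} \<Longrightarrow> \<sigma> (j + 1) < \<sigma> j"
    and sigma_pos: "\<And>j. j \<in> {1..n} \<Longrightarrow> \<sigma> j > 0"
    and b: "b \<in> carrier_vec n"
    and b_components: "\<And>j. j \<in> {1..n} \<Longrightarrow> scalar_prod (col V (j - 1)) b \<noteq> 0"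
    and ill_posed: "severely_ill_posed n \<sigma> \<or> moderately_ill_posed n \<sigma>"
    and gamma: "\<And>k. \<gamma> k = norm2_mat (A - lanczos_Q n A (A *\<^sub>v b) (k + 1) *
                  lanczos_T n A (A *\<^sub>v b) k * transpose_mat (lanczos_Q n A (A *\<^sub>v b) k))"
    and k: "k \<in> {1..n - 1}"
  shows "\<bar>lam (k + 1)\<bar> \<le> \<gamma> k \<and>
         \<gamma> k \<le> \<bar>lam (k + 1)\<bar> + \<bar>lam 1\<bar> *
           norm_sin_Theta n (span_vec n ((\<lambda>j. col V (j - 1)) ` {1..k})) (krylov n A (A *\<^sub>v b) k)"
proof -
  let ?w = "A *\<^sub>v b" and ?d = "\<lambda>i. lam (i + 1)"
  let ?Q = "lanczos_Q n A ?w k" and ?H = "col_range V 0 k"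
  have kn: "0 < k" "k < n" using k by auto
  have w: "?w \<in> carrier_vec n" using A by simp
  \<comment> \<open>The diagonal is indexed from 0, so \<open>?d k\<close> is \<open>lam (k + 1)\<close>.\<close>
  have d_less: "\<bar>?d j\<bar> < \<bar>?d i\<bar>" if "i < j" "j < n" for i j
    using that
  proof (induction j)
    case (Suc j)
    have "\<bar>?d (Suc j)\<bar> < \<bar>?d j\<bar>"
      using sigma_decreasing[of "j + 1"] sigma[of "j + 1"] sigma[of "j + 2"] Suc.prems by simp
    then show ?case using Suc by (cases "i = j") auto
  qed simp
  then have d_le: "\<bar>?d j\<bar> \<le> \<bar>?d i\<bar>" if "i \<le> j" "j < n" for i j
    using that by (cases "i = j") (auto intro: less_imp_le)
  have inj: "inj_on ?d {..<n}"
  proof (rule inj_onI)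
    fix i j assume "i \<in> {..<n}" "j \<in> {..<n}" "?d i = ?d j"
    then show "i = j" using d_less[of i j] d_less[of j i] by (cases i j rule: linorder_cases) auto
  qed
  have coords: "(transpose_mat V *\<^sub>v ?w) $ i \<noteq> 0" if i: "i < n" for i
  proof -
    have "(transpose_mat V *\<^sub>v ?w) $ i = ?d i * (transpose_mat V *\<^sub>v b) $ i"
      by (rule spectral_coordinate[OF V V_orth spectral b i])
    moreover have "?d i \<noteq> 0" using sigma_pos[of "i + 1"] sigma[of "i + 1"] i by auto
    moreover have "(transpose_mat V *\<^sub>v b) $ i \<noteq> 0" using b_components[of "i + 1"] i V by simp
    ultimately show ?thesis by simp
  qed
  have w0: "?w \<noteq> 0\<^sub>v n"
  proof
    assume eq: "?w = 0\<^sub>v n"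
    have "col V 0 \<bullet> 0\<^sub>v n = 0"
      by (rule scalar_prod_right_zero) (use V in auto)
    then show False using coords[of 0] kn V unfolding eq by simp
  qed
  have Q: "?Q \<in> carrier_mat n k" by (rule lanczos_Q_carrier)
  have Q_orth: "transpose_mat ?Q * ?Q = 1\<^sub>m k"
    by (rule lanczos_Q_orthonormal[OF A A_sym w w0])
      (use lanczos_no_breakdown[OF V V_orth spectral inj w coords] kn in auto)
  have gamma_k: "\<gamma> k = norm2_mat (A - A * ?Q * transpose_mat ?Q)"
    unfolding gamma mult_lanczos_Q[OF A w] ..
  have heads: "span_vec n ((\<lambda>j. col V (j - 1)) ` {1..k}) = span_vec n (set (cols ?H))"
  proof -
    have "(\<lambda>j. col V (j - 1)) ` {1..k} = col V ` {0..<k}"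
      by (simp only: image_Suc_atLeastLessThan[symmetric] atLeastLessThanSuc_atLeastAtMost[symmetric]
          image_image One_nat_def diff_Suc_Suc diff_zero)
    then show ?thesis by (simp only: set_cols_col_range)
  qed
  have "\<bar>?d k\<bar> \<le> norm2_mat (A - A * ?Q * transpose_mat ?Q)"
  proof (rule norm2_mat_ge_of_agree_on_kernel[OF V V_orth spectral _ Q kn(2)])
    show "A - A * ?Q * transpose_mat ?Q \<in> carrier_mat n n"
      using A Q by (intro carrier_matI) auto
    fix x :: "real vec" assume x: "x \<in> carrier_vec n" and Qx: "transpose_mat ?Q *\<^sub>v x = 0\<^sub>v k"
    show "(A - A * ?Q * transpose_mat ?Q) *\<^sub>v x = A *\<^sub>v x"
      unfolding deflation_mult_vec[OF A Q x] Qx minus_mult_mat_vec_zero[OF Q x] ..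
  qed (use d_le kn in auto)
  moreover have "norm2_mat (A - A * ?Q * transpose_mat ?Q) \<le> \<bar>?d k\<bar> + \<bar>?d 0\<bar> *
      norm_sin_Theta n (span_vec n (set (cols ?H))) (span_vec n (set (cols ?Q)))"
    by (rule norm2_mat_deflation_le[OF V V_orth spectral Q Q_orth]) (use d_le kn in auto)
  ultimately show ?thesis
    unfolding gamma_k heads krylov_eq_span_lanczos[OF A w w0] by simp
qed

end
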